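(* Consider the problem $\min_{x\in\mathbb{R}^N} g(x)+F(x)$, $F=\frac1n\sum_{i=1}^n f_i$, under the Problem Properties assumption, and let $(x^k,y_1^k,\dots,y_n^k)_{k\ge 0}$ be the iterates of the PVRSG algorithm with step-size $\lambda>0$, sampling probabilities $p_i$ and expected update frequencies $\eta_i$ (all given in the context). Let $x^\star$ be the unique solution and $y_i^\star=\nabla f_i(x^\star)$. (i) Suppose $\max_i \frac{L_i}{np_i}>\mu$. If there exists $\rho\in(0,\min_i\eta_i)$ such that $$\rho=\mu\lambda(2-\nu\lambda),\qquad \nu=\min_{\delta>0}\max_{i}\Big[(1+\delta^{-1})\frac{L_i}{np_i}\frac{\eta_i}{\eta_i-\rho}+(1+\delta)\frac{L_i}{np_i}-\delta\mu\Big],$$ then $$\mathbb{E}\Big[\|x^k-x^\star\|^2+\sum_{i=1}^n\widehat\gamma_i\|y_i^k-y_i^\star\|^2\Big]\in\mathcal{O}\big((1-\rho)^k\big),$$ where $\widehat\gamma_i=\frac{\lambda^2}{n^2p_i}\frac{1}{\eta_i-\rho}\big(1+\frac1{\delta^\star}\big)$ and $\delta^\star$ is the unique minimizer of the minimization problem over $\delta>0$ defining $\nu$. (ii) Suppose instead $\max_i\frac{L_i}{np_i}=\mu$. If there exists $\rho\in(0,\min_i\eta_i)$ such that $$\rho=\mu\lambda(2-\nu\lambda),\qquad \nu=\mu+\mu\max_i\frac{\eta_i}{\eta_i-\rho},$$ then for all $\tilde\rho\in(0,\rho)$ $$\mathbb{E}\Big[\|x^k-x^\star\|^2+\sum_{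i=1}^n\frac{\lambda^2}{n^2p_i}\frac{1}{\eta_i-\tilde\rho}\|y_i^k-y_i^\star\|^2\Big]\in\mathcal{O}\big((1-\tilde\rho)^k\big).$$
   Context: Problem Properties: $g:\mathbb{R}^N\to\mathbb{R}\cup\{\infty\}$ is closed, convex and proper. For every $i\in\{1,\dots,n\}$, $f_i:\mathbb{R}^N\to\mathbb{R}$ is convex, differentiable and $L_i$-smooth. $F=\frac1n\sum_{i=1}^n f_i$ is $\mu$-strongly convex, differentiable and $L$-smooth with $L\le\frac1n\sum_{i=1}^nL_i$. Here a convex $f$ is $L$-smooth ($L>0$) if it is differentiable and $\langle\nabla f(x)-\nabla f(y),x-y\rangle\ge\frac1L\|\nabla f(x)-\nabla f(y)\|^2$ for all $x,y$ (equivalently, $\nabla f$ is $L$-Lipschitz), and $f$ is $\mu$-strongly convex ($\mu>0$) if $f-\frac\mu2\|\cdot\|^2$ is convex. Consequently $g+F$ has a unique minimizer $x^\star$. The norm is Euclidean, and $\operatorname{prox}_{\lambda g}(z)=\arg\min_x \lambda g(x)+\frac12\|x-z\|^2$. PVRSG algorithm: given initial points $x^0,y_1^0,\dots,y_n^0\in\mathbb{R}^N$ and step-size $\lambda>0$, for $k=0,1,\dots$ randomly sample $(I^k,U_1^k,\dots,U_n^k)\in\{1,\dots,n\}\times\{0,1\}^n$ and set $$z^{k+1}=x^k-\tfrac{\lambda}{n}\Big(\tfrac1{p_{I^k}}(\nabla f_{I^k}(x^k)-y_{I^k}^k)+\sum_{i=1}^ny_i^k\Big),\quad x^{k+1}=\operatorname{prox}_{\lambda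 g}(z^{k+1}),$$ $$y_i^{k+1}=y_i^k+U_i^k(\nabla f_i(x^k)-y_i^k),\quad i=1,\dots,n.$$ The samples for different $k$ are independent and identically distributed (within one $k$ the joint law is arbitrary), with $P(I^k=i)=p_i>0$ and expected update frequency $\eta_i=\mathbb{E}[U_i^k]>0$ for all $i$ (by independence equal to the expectation conditioned on the history up to iteration $k$). *)

theory Defs
  imports "HOL-Probability.Probability" "HOL-Library.Landau_Symbols"
begin

definition grad :: "('a::real_inner \<Rightarrow> real) \<Rightarrow> 'a \<Rightarrow> 'a" where
  "grad f x = (THE D. GDERIV f x :> D)"

definition smooth_fun :: "real \<Rightarrow> ('a::real_inner \<Rightarrow> real) \<Rightarrow> bool" where
  "smooth_fun L f \<longleftrightarrow> 0 < L \<and> (\<forall>x. f differentiable (at x)) \<and>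
     (\<forall>x y. inner (grad f x - grad f y) (x - y) \<ge> 1 / L * (norm (grad f x - grad f y))\<^sup>2)"

definition strongly_convex_fun :: "real \<Rightarrow> ('a::real_inner \<Rightarrow> real) \<Rightarrow> bool" where
  "strongly_convex_fun \<mu> f \<longleftrightarrow> 0 < \<mu> \<and> convex_on UNIV (\<lambda>x. f x - \<mu> / 2 * (norm x)\<^sup>2)"

text \<open>Closedness and convexity of an extended-valued function are those of its epigraph;
  properness excludes the value \<open>-\<infinity>\<close>, so the function takes values in
  \<open>\<real> \<union> {\<infinity>}\<close>.\<close>

definition ext_epigraph :: "('a \<Rightarrow> ereal) \<Rightarrow> ('a \<times> real) set" where
  "ext_epigraph g = {(x, r). g x \<le> ereal r}"

definition closed_convex_proper :: "('a::real_normed_vector \<Rightarrow> ereal) \<Rightarrow> bool" where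
  "closed_convex_proper g \<longleftrightarrow> closed (ext_epigraph g) \<and> convex (ext_epigraph g) \<and>
     (\<forall>x. g x \<noteq> -\<infinity>) \<and> (\<exists>x. g x \<noteq> \<infinity>)"

definition prox :: "real \<Rightarrow> ('a::real_normed_vector \<Rightarrow> ereal) \<Rightarrow> 'a \<Rightarrow> 'a" where
  "prox lam g z =
     arg_min (\<lambda>x. ereal lam * g x + ereal (1 / 2 * (norm (x - z))\<^sup>2)) (\<lambda>_. True)"

text \<open>The indices \<open>1, \<dots>, n\<close> are the elements of a finite type \<open>'n\<close>, so that
  \<open>n = CARD('n)\<close>.\<close>

definition avg_fun :: "('n::finite \<Rightarrow> 'a \<Rightarrow> real) \<Rightarrow> 'a \<Rightarrow> real" where
  "avg_fun f x = 1 / real CARD('n) * (\<Sum>i\<in>UNIV. f i x)"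

text \<open>The iterates along one realisation \<open>I 0, U 0, I 1, U 1, \<dots>\<close> of the samples;
  \<open>U k i\<close> being true encodes \<open>U\<^sub>i\<^sup>k = 1\<close>.\<close>

definition pvrsg_iterates ::
  "real \<Rightarrow> ('a::real_inner \<Rightarrow> ereal) \<Rightarrow> ('n::finite \<Rightarrow> 'a \<Rightarrow> real) \<Rightarrow> ('n \<Rightarrow> real) \<Rightarrow>
   'a \<Rightarrow> ('n \<Rightarrow> 'a) \<Rightarrow> (nat \<Rightarrow> 'n) \<Rightarrow> (nat \<Rightarrow> 'n \<Rightarrow> bool) \<Rightarrow>
   (nat \<Rightarrow> 'a) \<Rightarrow> (nat \<Rightarrow> 'n \<Rightarrow> 'a) \<Rightarrow> bool" where
  "pvrsg_iterates lam g f p x0 y0 I U x y \<longleftrightarrow>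
     x 0 = x0 \<and> y 0 = y0 \<and>
     (\<forall>k. x (Suc k) = prox lam g (x k - (lam / real CARD('n)) *\<^sub>R
             ((1 / p (I k)) *\<^sub>R (grad (f (I k)) (x k) - y k (I k)) + (\<Sum>i\<in>UNIV. y k i)))) \<and>
     (\<forall>k i. y (Suc k) i = y k i + of_bool (U k i) *\<^sub>R (grad (f i) (x k) - y k i))"

definition nu_objective ::
  "real \<Rightarrow> ('n::finite \<Rightarrow> real) \<Rightarrow> ('n \<Rightarrow> real) \<Rightarrow> ('n \<Rightarrow> real) \<Rightarrow> real \<Rightarrow> real \<Rightarrow> real" where
  "nu_objective \<mu> L p \<eta> \<rho> \<delta> =
     (MAX i. (1 + 1 / \<delta>) * (L i / (real CARD('n) * p i)) * (\<eta> i / (\<eta> i - \<rho>))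
           + (1 + \<delta>) * (L i / (real CARD('n) * p i)) - \<delta> * \<mu>)"

definition lyapunov ::
  "('n::finite \<Rightarrow> real) \<Rightarrow> 'a::real_normed_vector \<Rightarrow> ('n \<Rightarrow> 'a) \<Rightarrow> 'a \<Rightarrow> ('n \<Rightarrow> 'a) \<Rightarrow> real" where
  "lyapunov \<gamma> xs ys x y = (norm (x - xs))\<^sup>2 + (\<Sum>i\<in>UNIV. \<gamma> i * (norm (y i - ys i))\<^sup>2)"

end

theory Submission
  imports Defs
begin

text \<open>The proof follows one Lyapunov function, the squared distance of the iterate to the solution plus
weighted squared errors of the stored gradients, and shows that its conditional expectation shrinks
by the factor \<open>1 - \<rho>\<close> in every iteration.

Let \<open>e = x - xs\<close> and let \<open>D\<close> be the difference of the full gradients at \<open>x\<close> and \<open>xs\<close>. The solution is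
a fixed point of the exact proximal gradient step and the proximal map is nonexpansive, so the new
distance is at most \<open>\<parallel>e - lam G\<parallel>\<close>, where \<open>G\<close> is the error of the sampled gradient relative to the full
gradient at \<open>xs\<close> (\<open>proximal_step_distance\<close>). The estimator is unbiased, so \<open>G\<close> has mean \<open>D\<close>. Its second
moment is bounded through the control variate decomposition with a free parameter \<open>\<delta>\<close>
(\<open>control_variate_second_moment\<close>), which produces a multiple of the stored errors, a multiple of the
current gradient differences and the negative term \<open>- \<delta> \<parallel>D\<parallel>\<^sup>2\<close>. The weights \<open>\<gamma>\<close> are made for absorbing
the stored errors; cocoercivity of the \<open>\<nabla>f i\<close> turns the gradient differences into \<open>\<langle>D, e\<rangle>\<close>; the negative
term contributes \<open>- \<delta> \<mu> \<langle>D, e\<rangle>\<close>. The total coefficient of \<open>lam\<^sup>2 \<langle>D, e\<rangle>\<close> is at most the objective that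
\<open>\<nu>\<close> minimizes over \<open>\<delta>\<close>, and \<open>\<rho> = \<mu> lam (2 - \<nu> lam)\<close> is what strong monotonicity \<open>\<mu> \<parallel>e\<parallel>\<^sup>2 \<le> \<langle>D, e\<rangle>\<close>
leaves (\<open>lyapunov_drift\<close>, \<open>pvrsg_step_contraction\<close>). Independence of the samples then iterates the
one-step bound (\<open>random_iteration_contraction\<close>).

It remains to choose \<open>\<delta>\<close>. If the largest \<open>L i / (n p i)\<close> exceeds \<open>\<mu>\<close>, the objective is strictly convex
and coercive in \<open>\<delta>\<close>, so it has a unique minimizer (\<open>nu_objective_ex1_min\<close>), which is used. If it equals
\<open>\<mu>\<close>, the objective is at most \<open>\<mu> + \<mu> (1 + 1/\<delta>) max (\<eta> i / (\<eta> i - \<rho>))\<close>, a bound that decreases to \<open>\<nu>\<close>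
as \<open>\<delta>\<close> tends to infinity but reaches it at no finite \<open>\<delta>\<close>; giving up a little rate, \<open>\<rho>' < \<rho>\<close>, makes
some finite \<open>\<delta>\<close> reach the value \<open>\<nu>\<close> that belongs to \<open>\<rho>\<close> (\<open>nu_objective_le_limit\<close>). The
Lyapunov function for that \<open>\<delta>\<close> has larger weights than the one in the claim and so dominates it.\<close>

section \<open>Gradients of convex functions\<close>

lemma GDERIV_unique:
  assumes "GDERIV f x :> D" "GDERIV f x :> D'"
  shows "D = D'"
proof -
  have "(\<lambda>h. inner h D) = (\<lambda>h. inner h D')"
    using assms has_derivative_unique unfolding gderiv_def by blast
  then have "inner (D - D') D = inner (D - D') D'" by meson
  then have "inner (D - D') (D - D') = 0"
    by (simp add: inner_diff_right)
  then show ?thesis by simp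
qed

lemma grad_eqI: "GDERIV f x :> D \<Longrightarrow> grad f x = D"
  unfolding grad_def using GDERIV_unique by blast

lemma GDERIV_grad:
  fixes f :: "'a::euclidean_space \<Rightarrow> real"
  assumes "f differentiable (at x)"
  shows "GDERIV f x :> grad f x"
proof -
  obtain f' where f': "(f has_derivative f') (at x)"
    using assms unfolding differentiable_def by blast
  interpret f': bounded_linear f' using f' by (rule has_derivative_bounded_linear)
  have "f' h = inner h (\<Sum>b\<in>Basis. f' b *\<^sub>R b)" for h
  proof -
    have "f' h = f' (\<Sum>b\<in>Basis. inner h b *\<^sub>R b)" by (simp add: euclidean_representation)
    also have "\<dots> = inner h (\<Sum>b\<in>Basis. f' b *\<^sub>R b)"
      by (simp add: f'.sum f'.scaleR inner_sum_right mult.commute)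
    finally show ?thesis .
  qed
  then have D: "GDERIV f x :> (\<Sum>b\<in>Basis. f' b *\<^sub>R b)"
    using f' unfolding gderiv_def by (metis (no_types, lifting) ext)
  show ?thesis
    unfolding grad_def by (rule theI[of "\<lambda>D. GDERIV f x :> D", OF D]) (rule GDERIV_unique[OF _ D])
qed

text \<open>A one-sided bound on the difference quotients at \<open>x\<close> along \<open>d\<close> survives the limit
\<open>t \<rightarrow> 0\<close>. Both first-order inequalities below, the tangent bound for a convex function and the
subgradient bound at a minimizer, are instances: convexity turns values on a segment into such a
bound.\<close>

lemma GDERIV_bound_from_segment:
  fixes h :: "'a::real_inner \<Rightarrow> real"
  assumes D: "GDERIV h x :> D"
    and le: "\<And>t. 0 < t \<Longrightarrow> t \<le> 1 \<Longrightarrow> h (x + t *\<^sub>R d) - h x \<le> c * t"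
  shows "inner D d \<le> c"
proof -
  have "((\<lambda>t. h (x + t *\<^sub>R d)) has_derivative (\<lambda>t. inner (t *\<^sub>R d) D)) (at 0)"
    using D unfolding gderiv_def
    by (intro has_derivative_compose[of "\<lambda>t. x + t *\<^sub>R d" "\<lambda>t. t *\<^sub>R d" 0 UNIV h])
       (auto intro!: derivative_eq_intros)
  then have "((\<lambda>t. h (x + t *\<^sub>R d)) has_field_derivative inner D d) (at 0)"
    unfolding has_field_derivative_def
    by (rule has_derivative_eq_rhs) (simp add: fun_eq_iff inner_commute[of D])
  then have "((\<lambda>t. (h (x + t *\<^sub>R d) - h x) / t) \<longlongrightarrow> inner D d) (at 0)"
    by (simp add: has_field_derivative_iff)
  then have lim: "((\<lambda>t. (h (x + t *\<^sub>R d) - h x) / t) \<longlongrightarrow> inner D d) (at_right 0)"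
    by (rule filterlim_mono) (auto simp: at_within_le_at)
  have "eventually (\<lambda>t. (h (x + t *\<^sub>R d) - h x) / t \<le> c) (at_right 0)"
    using eventually_at_right_less[of 0] eventually_at_rightI[of 0 1 "\<lambda>t. t \<le> (1::real)"]
    by (auto elim!: eventually_elim2 simp: divide_simps le)
  then show ?thesis
    using tendsto_upperbound[OF lim] by simp
qed

lemma convex_on_above_tangent:
  fixes q :: "'a::real_inner \<Rightarrow> real"
  assumes "convex_on UNIV q" "GDERIV q x :> D"
  shows "q x + inner D (v - x) \<le> q v"
proof -
  have "inner D (v - x) \<le> q v - q x"
  proof (rule GDERIV_bound_from_segment[OF assms(2)])
    fix t :: real assume t: "0 < t" "t \<le> 1"
    have "q ((1 - t) *\<^sub>R x + t *\<^sub>R v) \<le> (1 - t) * q x + t * q v"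
      using assms(1) t by (intro convex_onD) auto
    moreover have "(1 - t) *\<^sub>R x + t *\<^sub>R v = x + t *\<^sub>R (v - x)"
      by (simp add: algebra_simps)
    ultimately show "q (x + t *\<^sub>R (v - x)) - q x \<le> (q v - q x) * t"
      by (simp add: algebra_simps)
  qed
  then show ?thesis by simp
qed

lemma GDERIV_norm_square:
  "GDERIV (\<lambda>x. c / 2 * (norm x)\<^sup>2) x :> c *\<^sub>R x"
  unfolding gderiv_def power2_norm_eq_inner
  by (auto intro!: derivative_eq_intros simp: inner_commute algebra_simps)

text \<open>The tangent inequality for the convex part \<open>F - \<mu>/2 \<parallel>\<cdot>\<parallel>\<^sup>2\<close>, written at \<open>x\<close> and at \<open>v\<close>; in the sum the
function values cancel.\<close>

lemma strongly_convex_gradient_monotone: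
  fixes F :: "'a::euclidean_space \<Rightarrow> real"
  assumes F: "strongly_convex_fun \<mu> F" "\<And>x. F differentiable (at x)"
  shows "\<mu> * (norm (x - v))\<^sup>2 \<le> inner (grad F x - grad F v) (x - v)"
proof -
  let ?q = "\<lambda>x. F x - \<mu> / 2 * (norm x)\<^sup>2"
  have q: "convex_on UNIV ?q" using F(1) by (simp add: strongly_convex_fun_def)
  have D: "GDERIV ?q u :> grad F u - \<mu> *\<^sub>R u" for u
    by (intro GDERIV_diff GDERIV_grad GDERIV_norm_square F(2))
  show ?thesis
    using convex_on_above_tangent[OF q D, of x v] convex_on_above_tangent[OF q D, of v x]
    by (simp add: inner_diff_left inner_diff_right power2_norm_eq_inner inner_commute
        algebra_simps)
qed

lemma GDERIV_avg_fun:
  fixes f :: "'n::finite \<Rightarrow> 'a::euclidean_space \<Rightarrow> real"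
  assumes "\<And>i. f i differentiable (at x)"
  shows "GDERIV (avg_fun f) x :> (1 / real CARD('n)) *\<^sub>R (\<Sum>i\<in>UNIV. grad (f i) x)"
proof -
  have "(f i has_derivative (\<lambda>h. inner h (grad (f i) x))) (at x)" for i
    using GDERIV_grad[OF assms] by (simp add: gderiv_def)
  then show ?thesis
    unfolding gderiv_def avg_fun_def inner_scaleR_right inner_sum_right
    by (intro has_derivative_mult_right has_derivative_sum)
qed

section \<open>Minimizers of composite objectives and the proximal step\<close>

text \<open>The point just below the graph, \<open>(x1, g x1 - 1)\<close>, lies outside the closed convex epigraph, and a
hyperplane separates the two. Since the epigraph contains the point \<open>(x1, g x1)\<close> right above, the
hyperplane is not vertical, so it is the graph of an affine function below \<open>g\<close>.\<close>

lemma closed_convex_proper_affine_minorant: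
  fixes g :: "'a::euclidean_space \<Rightarrow> ereal"
  assumes "closed_convex_proper g"
  obtains a b where "\<And>v r. g v \<le> ereal r \<Longrightarrow> inner a v + b \<le> r"
proof -
  let ?E = "ext_epigraph g"
  obtain x1 where "g x1 \<noteq> \<infinity>" "g x1 \<noteq> -\<infinity>"
    using assms unfolding closed_convex_proper_def by blast
  then obtain r1 where r1: "g x1 = ereal r1" by (cases "g x1") auto
  have "(x1, r1 - 1) \<notin> ?E" by (simp add: ext_epigraph_def r1)
  moreover have "closed ?E" "convex ?E"
    using assms by (auto simp: closed_convex_proper_def)
  ultimately obtain w \<beta> where
    w: "inner w (x1, r1 - 1) < \<beta>" "\<forall>e\<in>?E. inner w e > \<beta>"
    using separating_hyperplane_closed_point by blast
  obtain c \<alpha> where c: "w = (c, \<alpha>)" by (cases w)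
  have sep: "\<beta> < inner c v + \<alpha> * r" if "g v \<le> ereal r" for v r
    using w(2) that by (force simp: c ext_epigraph_def)
  \<comment> \<open>The last coordinate of the normal vector is positive: the hyperplane lies between \<open>(x1, r1 - 1)\<close> and \<open>(x1, r1)\<close>.\<close>
  have "inner c x1 + \<alpha> * (r1 - 1) < inner c x1 + \<alpha> * r1"
    using w(1) sep[of x1 r1] by (simp add: c r1)
  then have \<alpha>: "0 < \<alpha>" by (simp add: algebra_simps)
  show thesis
  proof
    fix v r assume "g v \<le> ereal r"
    with sep[OF this] \<alpha> show "inner (- (1 / \<alpha>) *\<^sub>R c) v + \<beta> / \<alpha> \<le> r"
      by (simp add: field_simps)
  qed
qed

text \<open>The objective dominates an affine function plus \<open>c/2 \<parallel>\<cdot>\<parallel>\<^sup>2\<close>, so it is coercive. As \<open>g\<close> is extended-valued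
and only lower semicontinuous, compactness is applied one dimension higher: the continuous function
\<open>(v, r) \<mapsto> r + h v\<close> is minimized over a sublevel set in the epigraph of \<open>g\<close>, which is closed, and
bounded by coercivity.\<close>

lemma ex_minimizer_strongly_convex:
  fixes g :: "'a::euclidean_space \<Rightarrow> ereal" and h :: "'a \<Rightarrow> real"
  assumes g: "closed_convex_proper g"
    and h: "strongly_convex_fun c h" "\<And>x. h differentiable (at x)"
  shows "\<exists>v. is_arg_min (\<lambda>v. g v + ereal (h v)) (\<lambda>_. True) v"
proof -
  have c: "0 < c" using h(1) by (simp add: strongly_convex_fun_def)
  obtain a b where ab: "\<And>v r. g v \<le> ereal r \<Longrightarrow> inner a v + b \<le> r"
    using closed_convex_proper_affine_minorant[OF g] by blast
  obtain x1 where "g x1 \<noteq> \<infinity>" "g x1 \<noteq> -\<infinity>"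
    using g unfolding closed_convex_proper_def by blast
  then obtain r1 where r1: "g x1 = ereal r1" by (cases "g x1") auto
  let ?q = "\<lambda>x. h x - c / 2 * (norm x)\<^sup>2"
  have q: "convex_on UNIV ?q" using h(1) by (simp add: strongly_convex_fun_def)
  have Dq: "GDERIV ?q u :> grad h u - c *\<^sub>R u" for u
    by (intro GDERIV_diff GDERIV_grad GDERIV_norm_square h(2))
  define d where "d = grad h 0"
  have hlow: "h 0 + inner d v + c / 2 * (norm v)\<^sup>2 \<le> h v" for v
    using convex_on_above_tangent[OF q Dq, of 0 v] by (simp add: d_def)
  define m where "m = r1 + h x1"
  let ?obj = "\<lambda>(v, r). r + h v"
  define T where "T = ext_epigraph g \<inter> {e. ?obj e \<le> m}"
  have cont: "continuous_on UNIV ?obj"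
  proof -
    have "continuous_on UNIV h"
      using h(2) by (simp add: continuous_at_imp_continuous_on differentiable_imp_continuous_within)
    then show ?thesis
      unfolding case_prod_beta by (auto intro!: continuous_intros intro: continuous_on_compose2)
  qed
  have closed: "closed T"
    unfolding T_def using g cont
    by (intro closed_Int closed_Collect_le) (auto simp: closed_convex_proper_def)
  \<comment> \<open>Half of the quadratic growth absorbs the linear terms, by completing the square; the other half bounds \<open>v\<close>.\<close>
  define B where "B = sqrt (4 / c * (m - b - h 0 + (norm (a + d))\<^sup>2 / c))"
  have vB: "norm v \<le> B" if "(v, r) \<in> T" for v r
  proof -
    have *: "inner a v + b \<le> r" "r + h v \<le> m"
      using that ab by (auto simp: T_def ext_epigraph_def)
    have "0 \<le> c * (norm ((1/2) *\<^sub>R v + (1 / c) *\<^sub>R (a + d)))\<^sup>2" using c by simp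
    also have "\<dots> = c / 4 * (norm v)\<^sup>2 + inner (a + d) v + (norm (a + d))\<^sup>2 / c"
      using c unfolding power2_norm_eq_inner
      by (simp add: inner_add_left inner_add_right inner_commute field_simps power2_eq_square)
    finally have "c / 4 * (norm v)\<^sup>2 \<le> m - b - h 0 + (norm (a + d))\<^sup>2 / c"
      using * hlow[of v] unfolding inner_add_left by linarith
    then have "(norm v)\<^sup>2 \<le> 4 / c * (m - b - h 0 + (norm (a + d))\<^sup>2 / c)"
      using c by (simp add: field_simps)
    then show ?thesis unfolding B_def by (rule real_le_rsqrt)
  qed
  have "T \<subseteq> cball 0 B \<times> {- norm a * B + b .. m - h 0 + norm d * B}"
  proof clarsimp
    fix v r assume T: "(v, r) \<in> T"
    have *: "inner a v + b \<le> r" "r + h v \<le> m"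
      using T ab by (auto simp: T_def ext_epigraph_def)
    have "norm v \<le> B" by (rule vB[OF T])
    then have "\<bar>inner a v\<bar> \<le> norm a * B" "\<bar>inner d v\<bar> \<le> norm d * B"
      by (meson Cauchy_Schwarz_ineq2 mult_left_mono norm_ge_zero order_trans)+
    moreover have "0 \<le> c / 2 * (norm v)\<^sup>2" using c by simp
    ultimately show "norm v \<le> B \<and> b - norm a * B \<le> r \<and> r \<le> m - h 0 + norm d * B"
      using * hlow[of v] \<open>norm v \<le> B\<close> by linarith
  qed
  moreover have "bounded (cball 0 B \<times> {- norm a * B + b .. m - h 0 + norm d * B} :: ('a \<times> real) set)"
    by (intro bounded_Times bounded_cball bounded_closed_interval)
  ultimately have "compact T"
    using closed bounded_subset by (auto simp: compact_eq_bounded_closed)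
  moreover have "(x1, r1) \<in> T" by (simp add: T_def ext_epigraph_def r1 m_def)
  ultimately obtain e0 where e0: "e0 \<in> T" "\<forall>e\<in>T. ?obj e0 \<le> ?obj e"
    using continuous_attains_inf[of T ?obj] continuous_on_subset[OF cont subset_UNIV] by blast
  obtain v0 r0 where "e0 = (v0, r0)" by (cases e0)
  with e0 have T0: "(v0, r0) \<in> T"
    and min: "\<And>v r. (v, r) \<in> T \<Longrightarrow> r0 + h v0 \<le> r + h v"
    by auto
  have "g v0 + ereal (h v0) \<le> g v + ereal (h v)" for v
  proof (cases "g v")
    case (real r)
    have "r0 + h v0 \<le> r + h v"
      using min[of v r] T0 real by (cases "r + h v \<le> m") (auto simp: T_def ext_epigraph_def)
    moreover have "g v0 + ereal (h v0) \<le> ereal (r0 + h v0)"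
      using T0 by (cases "g v0") (auto simp: T_def ext_epigraph_def)
    ultimately show ?thesis
      using real by (simp add: order_trans)
  qed (use g in \<open>auto simp: closed_convex_proper_def\<close>)
  then show ?thesis by (auto simp: is_arg_min_linorder)
qed

text \<open>Fermat's rule: \<open>-D\<close> is a subgradient of \<open>g\<close> at a minimizer of \<open>g + h\<close>. The subgradient inequality is
phrased through points of the epigraph, so that no arithmetic with infinite values occurs.\<close>

lemma minimizer_subgradient:
  fixes g :: "'a::euclidean_space \<Rightarrow> ereal" and h :: "'a \<Rightarrow> real"
  assumes g: "closed_convex_proper g"
    and D: "GDERIV h x :> D"
    and min: "is_arg_min (\<lambda>v. g v + ereal (h v)) (\<lambda>_. True) x"
  obtains s where "g x = ereal s" "\<And>v r. g v \<le> ereal r \<Longrightarrow> s - inner D (v - x) \<le> r"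
proof -
  have le: "g x + ereal (h x) \<le> g v + ereal (h v)" for v
    using min by (auto simp: is_arg_min_linorder)
  obtain x1 where "g x1 \<noteq> \<infinity>" "g x1 \<noteq> -\<infinity>" "g x \<noteq> -\<infinity>"
    using g unfolding closed_convex_proper_def by blast
  then obtain s where s: "g x = ereal s"
    using le[of x1] by (cases "g x1"; cases "g x") auto
  show thesis
  proof (rule that[OF s])
    fix v r assume r: "g v \<le> ereal r"
    have "inner (- D) (v - x) \<le> r - s"
    proof (rule GDERIV_bound_from_segment[OF GDERIV_minus[OF D]])
      fix t :: real assume t: "0 < t" "t \<le> 1"
      have "convex (ext_epigraph g)" using g by (simp add: closed_convex_proper_def)
      moreover have "(x, s) \<in> ext_epigraph g" "(v, r) \<in> ext_epigraph g"
        using s r by (auto simp: ext_epigraph_def)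
      ultimately have "(1 - t) *\<^sub>R (x, s) + t *\<^sub>R (v, r) \<in> ext_epigraph g"
        using t unfolding convex_alt by (meson less_imp_le)
      then have "g ((1 - t) *\<^sub>R x + t *\<^sub>R v) \<le> ereal ((1 - t) * s + t * r)"
        by (simp add: ext_epigraph_def)
      moreover have "(1 - t) *\<^sub>R x + t *\<^sub>R v = x + t *\<^sub>R (v - x)"
        by (simp add: algebra_simps)
      ultimately have "g (x + t *\<^sub>R (v - x)) \<le> ereal ((1 - t) * s + t * r)" by simp
      then have "s + h x \<le> (1 - t) * s + t * r + h (x + t *\<^sub>R (v - x))"
        using le[of "x + t *\<^sub>R (v - x)"] s
        by (cases "g (x + t *\<^sub>R (v - x))") auto
      then show "- h (x + t *\<^sub>R (v - x)) - - h x \<le> (r - s) * t"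
        by (simp add: algebra_simps)
    qed
    then show "s - inner D (v - x) \<le> r" by simp
  qed
qed

text \<open>Monotonicity of the subdifferential of \<open>g\<close>, read off at two minimizers with different smooth parts.\<close>

lemma minimizers_gradient_antimonotone:
  fixes g :: "'a::euclidean_space \<Rightarrow> ereal"
  assumes g: "closed_convex_proper g"
    and "GDERIV h1 x1 :> D1" "is_arg_min (\<lambda>v. g v + ereal (h1 v)) (\<lambda>_. True) x1"
    and "GDERIV h2 x2 :> D2" "is_arg_min (\<lambda>v. g v + ereal (h2 v)) (\<lambda>_. True) x2"
  shows "inner (D1 - D2) (x1 - x2) \<le> 0"
proof -
  obtain s1 where 1: "g x1 = ereal s1" "\<And>v r. g v \<le> ereal r \<Longrightarrow> s1 - inner D1 (v - x1) \<le> r"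
    using minimizer_subgradient[OF g assms(2,3)] by blast
  obtain s2 where 2: "g x2 = ereal s2" "\<And>v r. g v \<le> ereal r \<Longrightarrow> s2 - inner D2 (v - x2) \<le> r"
    using minimizer_subgradient[OF g assms(4,5)] by blast
  show ?thesis
    using 1(2)[of x2 s2] 2(2)[of x1 s1] 1(1) 2(1)
    by (simp add: inner_diff_left inner_diff_right)
qed

text \<open>The minimum in the definition of the proximal point is attained, because the quadratic term is
strongly convex; hence the choice operator returns a minimizer. Dividing by \<open>lam\<close> brings the objective
into the form \<open>g + h\<close>.\<close>

lemma prox_is_arg_min:
  fixes g :: "'a::euclidean_space \<Rightarrow> ereal"
  assumes g: "closed_convex_proper g" and lam: "0 < lam"
  shows "is_arg_min (\<lambda>x. g x + ereal (1 / (2 * lam) * (norm (x - z))\<^sup>2)) (\<lambda>_. True) (prox lam g z)"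
proof -
  let ?h = "\<lambda>x. 1 / (2 * lam) * (norm (x - z))\<^sup>2"
  let ?k = "\<lambda>x. g x + ereal (?h x)"
  have scale: "ereal lam * g x + ereal (1 / 2 * (norm (x - z))\<^sup>2) = ereal lam * ?k x" for x
    using lam g by (cases "g x") (auto simp: closed_convex_proper_def field_simps)
  have "strongly_convex_fun (1 / lam) ?h"
  proof -
    have eq: "?h x - 1 / lam / 2 * (norm x)\<^sup>2 = inner (- (1 / lam) *\<^sub>R z) x + 1 / (2 * lam) * (norm z)\<^sup>2" for x
      using lam unfolding power2_norm_eq_inner
      by (simp add: inner_diff_left inner_diff_right inner_commute field_simps)
    have affine: "convex_on UNIV (\<lambda>x. inner w x + k)" for w :: 'a and k :: real
      by (rule convex_onI) (auto simp: inner_add_right algebra_simps)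
    have "convex_on UNIV (\<lambda>x. inner (- (1 / lam) *\<^sub>R z) x + 1 / (2 * lam) * (norm z)\<^sup>2)"
      by (rule affine)
    then show ?thesis using lam by (simp only: strongly_convex_fun_def eq) simp
  qed
  moreover have "?h differentiable (at x)" for x
    using lam unfolding power2_norm_eq_inner by (auto intro!: derivative_intros)
  ultimately obtain v where v: "is_arg_min ?k (\<lambda>_. True) v"
    using ex_minimizer_strongly_convex[OF g] by blast
  have iff: "is_arg_min (\<lambda>x. ereal lam * ?k x) (\<lambda>_. True) v = is_arg_min ?k (\<lambda>_. True) v" for v
    using lam by (simp add: is_arg_min_linorder ereal_mult_le_mult_iff)
  show ?thesis
    using v unfolding prox_def scale arg_min_def
    by (subst iff[symmetric], subst (asm) iff[symmetric]) (rule someI)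
qed

text \<open>Optimality says \<open>xs = prox (xs - lam D)\<close>, and the proximal map is nonexpansive. Both facts are obtained
at once: the proximal point and \<open>xs\<close> are minimizers of \<open>g\<close> plus different smooth functions, so the
monotonicity inequality applies to them, and Cauchy-Schwarz finishes.\<close>

lemma proximal_step_distance:
  fixes g :: "'a::euclidean_space \<Rightarrow> ereal"
  assumes g: "closed_convex_proper g" and lam: "0 < lam"
    and D: "GDERIV F xs :> D" and xs: "is_arg_min (\<lambda>v. g v + ereal (F v)) (\<lambda>_. True) xs"
  shows "norm (prox lam g z - xs) \<le> norm (z + lam *\<^sub>R D - xs)"
proof -
  let ?u = "prox lam g z"
  have "GDERIV (\<lambda>x. 1 / (2 * lam) * (norm (x - z))\<^sup>2) ?u :> (1 / lam) *\<^sub>R (?u - z)"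
    unfolding gderiv_def power2_norm_eq_inner
    using lam by (auto intro!: derivative_eq_intros ext simp: inner_commute inner_diff_left inner_diff_right field_simps)
  from minimizers_gradient_antimonotone[OF g this prox_is_arg_min[OF g lam] D xs]
  have "lam * inner ((1 / lam) *\<^sub>R (?u - z) - D) (?u - xs) \<le> 0"
    using lam by (simp add: mult_le_0_iff)
  moreover have "lam * inner ((1 / lam) *\<^sub>R (?u - z) - D) (?u - xs)
      = inner (?u - z - lam *\<^sub>R D) (?u - xs)"
    using lam by (simp add: inner_diff_left inner_diff_right algebra_simps)
  moreover have "inner (?u - z - lam *\<^sub>R D) (?u - xs)
      = (norm (?u - xs))\<^sup>2 - inner (z + lam *\<^sub>R D - xs) (?u - xs)"
    unfolding power2_norm_eq_inner by (simp add: inner_diff_left inner_add_left)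
  ultimately have "(norm (?u - xs))\<^sup>2 \<le> norm (z + lam *\<^sub>R D - xs) * norm (?u - xs)"
    using norm_cauchy_schwarz[of "z + lam *\<^sub>R D - xs" "?u - xs"] by linarith
  then show ?thesis
    by (cases "norm (?u - xs) = 0") (auto simp: power2_eq_square)
qed

section \<open>Iterations driven by independent finite-valued samples\<close>

text \<open>All randomness up to a given iteration takes finitely many values, so expectations are finite sums.
This makes every function of the iterates measurable and integrable; in particular no measurability
of the proximal map has to be established.\<close>

lemma (in prob_space) expectation_finite_range:
  fixes h :: "'b \<Rightarrow> real"
  assumes A: "finite A" "\<And>\<omega>. \<omega> \<in> space M \<Longrightarrow> X \<omega> \<in> A"
    and ev: "\<And>a. a \<in> A \<Longrightarrow> {\<omega> \<in> space M. X \<omega> = a} \<in> events"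
  shows "integrable M (\<lambda>\<omega>. h (X \<omega>))"
    and "expectation (\<lambda>\<omega>. h (X \<omega>)) = (\<Sum>a\<in>A. prob {\<omega> \<in> space M. X \<omega> = a} * h a)"
proof -
  let ?S = "\<lambda>\<omega>. \<Sum>a\<in>A. indicator {\<omega> \<in> space M. X \<omega> = a} \<omega> * h a"
  have eq: "h (X \<omega>) = ?S \<omega>" if "\<omega> \<in> space M" for \<omega>
  proof -
    have "?S \<omega> = (\<Sum>a\<in>A. if a = X \<omega> then h a else 0)"
      using that by (intro sum.cong) (auto simp: indicator_def)
    then show ?thesis using A that by simp
  qed
  have int: "integrable M (\<lambda>\<omega>. indicator {\<omega> \<in> space M. X \<omega> = a} \<omega> * h a)" if "a \<in> A" for a
    using integrable_mult_left[OF integrable_real_indicator[OF ev[OF that]]] by (simp add: less_top[symmetric])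
  show "integrable M (\<lambda>\<omega>. h (X \<omega>))"
    using int by (subst Bochner_Integration.integrable_cong[OF refl eq]) auto
  have "expectation (\<lambda>\<omega>. h (X \<omega>)) = expectation ?S"
    using eq by (intro Bochner_Integration.integral_cong) auto
  also have "\<dots> = (\<Sum>a\<in>A. prob {\<omega> \<in> space M. X \<omega> = a} * h a)"
  proof -
    have "{\<omega> \<in> space M. X \<omega> = a} \<inter> space M = {\<omega> \<in> space M. X \<omega> = a}" for a by auto
    then show ?thesis
      by (simp only: Bochner_Integration.integral_sum[OF int] integral_mult_left_zero
          Bochner_Integration.integral_indicator)
  qed
  finally show "expectation (\<lambda>\<omega>. h (X \<omega>)) = (\<Sum>a\<in>A. prob {\<omega> \<in> space M. X \<omega> = a} * h a)" .
qed

lemma (in prob_space) indep_vars_event: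
  assumes "indep_vars (\<lambda>_. count_space UNIV) W UNIV"
  shows "{\<omega> \<in> space M. W j \<omega> = b} \<in> events"
proof -
  have "W j \<in> measurable M (count_space UNIV)" using assms by (auto simp: indep_vars_def)
  then have "W j -` {b} \<inter> space M \<in> events" by (rule measurable_sets) auto
  also have "W j -` {b} \<inter> space M = {\<omega> \<in> space M. W j \<omega> = b}" by auto
  finally show ?thesis .
qed

text \<open>A sample is independent of the list of earlier samples. Both events are finite intersections of events
about single samples, for which independence gives products.\<close>

lemma (in prob_space) indep_vars_history:
  fixes W :: "nat \<Rightarrow> 'a \<Rightarrow> 'b"
  assumes indep: "indep_vars (\<lambda>_. count_space UNIV) W UNIV"
  defines "hist \<equiv> (\<lambda>k \<omega>. map (\<lambda>j. W j \<omega>) [0..<k])"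
  shows "{\<omega> \<in> space M. hist k \<omega> = bs} \<in> events"
    and "prob {\<omega> \<in> space M. hist (Suc k) \<omega> = bs @ [b]} =
      prob {\<omega> \<in> space M. hist k \<omega> = bs} * prob {\<omega> \<in> space M. W k \<omega> = b}"
proof -
  note W = indep_vars_event[OF indep]
  have hist_eq: "{\<omega> \<in> space M. hist k \<omega> = bs} =
      (if length bs = k then {\<omega> \<in> space M. \<forall>j\<in>{..<k}. W j \<omega> = bs ! j} else {})" for k bs
    by (auto simp: hist_def list_eq_iff_nth_eq)
  have "{\<omega> \<in> space M. \<forall>j\<in>{..<k}. W j \<omega> = bs ! j} \<in> events"
    by (intro sets.sets_Collect_finite_All W) simp
  moreover have "{\<omega> \<in> space M. hist k \<omega> = bs}
      \<in> {{}, {\<omega> \<in> space M. \<forall>j\<in>{..<k}. W j \<omega> = bs ! j}}"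
    by (cases "length bs = k") (simp_all add: hist_eq)
  ultimately show "{\<omega> \<in> space M. hist k \<omega> = bs} \<in> events"
    by (elim insertE) (simp_all only: sets.empty_sets empty_iff)
  have prod: "prob {\<omega> \<in> space M. hist k \<omega> = bs} =
      (if length bs = k then \<Prod>j<k. prob {\<omega> \<in> space M. W j \<omega> = bs ! j} else 0)" for k bs
  proof (cases "k = 0")
    case True
    then show ?thesis unfolding hist_eq by (simp add: prob_space)
  next
    case False
    have "prob (\<Inter>j\<in>{..<k}. W j -` {bs ! j} \<inter> space M)
        = (\<Prod>j\<in>{..<k}. prob (W j -` {bs ! j} \<inter> space M))"
      by (rule indep_varsD[OF indep]) (use False in auto)
    moreover have "(\<Inter>j\<in>{..<k}. W j -` {bs ! j} \<inter> space M) = {\<omega> \<in> space M. \<forall>j\<in>{..<k}. W j \<omega> = bs ! j}"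
      using False by auto
    moreover have "W j -` {b} \<inter> space M = {\<omega> \<in> space M. W j \<omega> = b}" for j b by auto
    ultimately show ?thesis unfolding hist_eq by simp
  qed
  show "prob {\<omega> \<in> space M. hist (Suc k) \<omega> = bs @ [b]} =
      prob {\<omega> \<in> space M. hist k \<omega> = bs} * prob {\<omega> \<in> space M. W k \<omega> = b}"
    by (auto simp: prod nth_append)
qed

text \<open>The state after \<open>k\<close> steps is a deterministic function of the first \<open>k\<close> samples.\<close>

lemma (in prob_space) random_iteration_expectation:
  fixes W :: "nat \<Rightarrow> 'a \<Rightarrow> 'b::finite" and S :: "nat \<Rightarrow> 'a \<Rightarrow> 's" and V :: "'s \<Rightarrow> real"
  assumes indep: "indep_vars (\<lambda>_. count_space UNIV) W UNIV"
    and S0: "\<And>\<omega>. \<omega> \<in> space M \<Longrightarrow> S 0 \<omega> = s0"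
    and SSuc: "\<And>k \<omega>. \<omega> \<in> space M \<Longrightarrow> S (Suc k) \<omega> = step (W k \<omega>) (S k \<omega>)"
  shows "integrable M (\<lambda>\<omega>. V (S k \<omega>))"
    and "expectation (\<lambda>\<omega>. V (S k \<omega>)) = (\<Sum>bs | length bs = k.
      prob {\<omega> \<in> space M. map (\<lambda>j. W j \<omega>) [0..<k] = bs} * V (fold step bs s0))"
proof -
  let ?hist = "\<lambda>\<omega>. map (\<lambda>j. W j \<omega>) [0..<k]"
  let ?V = "\<lambda>bs. V (fold step bs s0)"
  have "S k \<omega> = fold step (?hist \<omega>) s0" if "\<omega> \<in> space M" for \<omega>
    using that by (induction k) (auto simp: S0 SSuc)
  then have S: "V (S k \<omega>) = ?V (?hist \<omega>)" if "\<omega> \<in> space M" for \<omega>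
    using that by simp
  have fin: "finite {bs :: 'b list. length bs = k}"
    using finite_lists_length_eq[of "UNIV :: 'b set" k] by simp
  note ex = expectation_finite_range[of "{bs. length bs = k}" ?hist ?V,
      OF fin _ indep_vars_history(1)[OF indep]]
  show "integrable M (\<lambda>\<omega>. V (S k \<omega>))"
    using ex(1) by (subst Bochner_Integration.integrable_cong[OF refl S]) auto
  have "expectation (\<lambda>\<omega>. V (S k \<omega>)) = expectation (\<lambda>\<omega>. ?V (?hist \<omega>))"
    by (rule Bochner_Integration.integral_cong[OF refl S])
  also have "\<dots> = (\<Sum>bs | length bs = k. prob {\<omega> \<in> space M. ?hist \<omega> = bs} * ?V bs)"
    by (rule ex(2)) simp_all
  finally show "expectation (\<lambda>\<omega>. V (S k \<omega>)) =
      (\<Sum>bs | length bs = k. prob {\<omega> \<in> space M. ?hist \<omega> = bs} * ?V bs)" .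
qed

text \<open>The tower property for a state driven by independent samples: it suffices to bound the expected
value after one step from each fixed state, since conditioning on the past freezes the state and
leaves the law of the next sample unchanged.\<close>

lemma (in prob_space) random_iteration_contraction:
  fixes W :: "nat \<Rightarrow> 'a \<Rightarrow> 'b::finite" and S :: "nat \<Rightarrow> 'a \<Rightarrow> 's" and V :: "'s \<Rightarrow> real"
  assumes indep: "indep_vars (\<lambda>_. count_space UNIV) W UNIV"
    and S0: "\<And>\<omega>. \<omega> \<in> space M \<Longrightarrow> S 0 \<omega> = s0"
    and SSuc: "\<And>k \<omega>. \<omega> \<in> space M \<Longrightarrow> S (Suc k) \<omega> = step (W k \<omega>) (S k \<omega>)"
    and contr: "\<And>k s. expectation (\<lambda>\<omega>. V (step (W k \<omega>) s)) \<le> c * V s"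
    and c: "0 \<le> c"
  shows "expectation (\<lambda>\<omega>. V (S k \<omega>)) \<le> c ^ k * V s0"
proof -
  define H where "H k = {bs :: 'b list. length bs = k}" for k :: nat
  let ?P = "\<lambda>k bs. prob {\<omega> \<in> space M. map (\<lambda>j. W j \<omega>) [0..<k] = bs}"
  let ?V = "\<lambda>bs. V (fold step bs s0)"
  have "(\<Sum>bs\<in>H k. ?P k bs * ?V bs) \<le> c ^ k * V s0"
  proof (induction k)
    case 0
    have "H 0 = {[]}" by (auto simp: H_def)
    then show ?case by (simp add: prob_space)
  next
    case (Suc k)
    have H_Suc: "H (Suc k) = (\<lambda>(bs, b). bs @ [b]) ` (H k \<times> UNIV)"
      by (force simp: H_def image_iff length_Suc_conv_rev)
    have "(\<Sum>bs\<in>H (Suc k). ?P (Suc k) bs * ?V bs)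
        = (\<Sum>(bs, b)\<in>H k \<times> UNIV. ?P (Suc k) (bs @ [b]) * ?V (bs @ [b]))"
      unfolding H_Suc by (subst sum.reindex) (auto simp: inj_on_def case_prod_beta)
    also have "\<dots> = (\<Sum>bs\<in>H k. \<Sum>b\<in>UNIV. ?P (Suc k) (bs @ [b]) * ?V (bs @ [b]))"
      by (rule sum.cartesian_product[symmetric])
    also have "\<dots> = (\<Sum>bs\<in>H k. ?P k bs * (\<Sum>b\<in>UNIV. prob {\<omega> \<in> space M. W k \<omega> = b} * V (step b (fold step bs s0))))"
      by (simp only: indep_vars_history(2)[OF indep] sum_distrib_left mult.assoc fold_append
          fold.simps o_apply id_apply)
    also have "\<dots> = (\<Sum>bs\<in>H k. ?P k bs * expectation (\<lambda>\<omega>. V (step (W k \<omega>) (fold step bs s0))))"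
      using expectation_finite_range(2)[OF finite_class.finite_UNIV UNIV_I indep_vars_event[OF indep],
          of "\<lambda>b. V (step b s)" k for s]
      by simp
    also have "\<dots> \<le> (\<Sum>bs\<in>H k. ?P k bs * (c * ?V bs))"
      by (intro sum_mono mult_left_mono contr) auto
    also have "\<dots> = c * (\<Sum>bs\<in>H k. ?P k bs * ?V bs)"
      by (simp add: sum_distrib_left mult_ac)
    also have "\<dots> \<le> c * (c ^ k * V s0)"
      by (rule mult_left_mono[OF Suc.IH c])
    finally show ?case by simp
  qed
  then show ?thesis
    using random_iteration_expectation(2)[OF indep S0 SSuc, of V k] by (simp add: H_def)
qed

section \<open>The second moment of a control variate estimator\<close>

text \<open>The bias-variance identity for the finite probability vector \<open>p\<close>, with the centred vectors shifted by
\<open>c\<close>. With \<open>c = 0\<close> it says that the variance is the second moment minus the squared norm of the mean.\<close>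

lemma weighted_variance:
  fixes X :: "'n::finite \<Rightarrow> 'a::real_inner" and p :: "'n \<Rightarrow> real"
  assumes "(\<Sum>i\<in>UNIV. p i) = 1"
  shows "(\<Sum>i\<in>UNIV. p i * (norm (X i - (\<Sum>j\<in>UNIV. p j *\<^sub>R X j) + c))\<^sup>2)
    = (\<Sum>i\<in>UNIV. p i * (norm (X i))\<^sup>2) - (norm (\<Sum>j\<in>UNIV. p j *\<^sub>R X j))\<^sup>2 + (norm c)\<^sup>2"
proof -
  define m where "m = (\<Sum>j\<in>UNIV. p j *\<^sub>R X j)"
  have "(norm (X i - m + c))\<^sup>2 = (norm (X i))\<^sup>2 + 2 * inner (X i) (c - m) + (norm (c - m))\<^sup>2" for i
    unfolding power2_norm_eq_inner
    by (simp add: inner_add_left inner_add_right inner_diff_left inner_diff_right inner_commute)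
  then have "p i * (norm (X i - m + c))\<^sup>2
      = p i * (norm (X i))\<^sup>2 + 2 * inner (p i *\<^sub>R X i) (c - m) + p i * (norm (c - m))\<^sup>2" for i
    by (simp add: distrib_left)
  then have "(\<Sum>i\<in>UNIV. p i * (norm (X i - m + c))\<^sup>2)
    = (\<Sum>i\<in>UNIV. p i * (norm (X i))\<^sup>2) + 2 * inner m (c - m) + (\<Sum>i\<in>UNIV. p i) * (norm (c - m))\<^sup>2"
    by (simp only: m_def inner_sum_left sum.distrib sum_distrib_left sum_distrib_right)
  also have "\<dots> = (\<Sum>i\<in>UNIV. p i * (norm (X i))\<^sup>2) - (norm m)\<^sup>2 + (norm c)\<^sup>2"
    unfolding power2_norm_eq_inner assms
    by (simp add: inner_diff_left inner_diff_right inner_commute)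
  finally show ?thesis by (simp add: m_def)
qed

text \<open>The difference of the two sides is \<open>\<delta> \<parallel>a + b/\<delta>\<parallel>\<^sup>2\<close>.\<close>

lemma norm_diff_square_Young:
  fixes a b :: "'a::real_inner"
  assumes "0 < \<delta>"
  shows "(norm (a - b))\<^sup>2 \<le> (1 + \<delta>) * (norm a)\<^sup>2 + (1 + 1 / \<delta>) * (norm b)\<^sup>2"
proof -
  have "0 \<le> \<delta> * (norm (a + (1 / \<delta>) *\<^sub>R b))\<^sup>2" using assms by simp
  also have "\<dots> = (1 + \<delta>) * (norm a)\<^sup>2 + (1 + 1 / \<delta>) * (norm b)\<^sup>2 - (norm (a - b))\<^sup>2"
    using assms unfolding power2_norm_eq_inner
    by (simp add: inner_add_left inner_add_right inner_diff_left inner_diff_right inner_commute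
        field_simps)
  finally show ?thesis by simp
qed

text \<open>With \<open>a\<close> and \<open>b\<close> the means of \<open>A\<close> and \<open>B\<close>, the vector on the left is \<open>(A i - a) - (B i - b) + a\<close>, a
centred vector plus its mean \<open>a\<close>. Young's inequality splits the centred part. The variance of \<open>B\<close> is
bounded by its second moment, while that of \<open>A\<close> is kept exact: together with \<open>\<parallel>a\<parallel>\<^sup>2\<close> from the mean
this gives the negative term \<open>- \<delta> \<parallel>a\<parallel>\<^sup>2\<close>, the origin of the summand \<open>- \<delta> \<mu>\<close> in the definition of \<open>\<nu>\<close>.\<close>

lemma control_variate_second_moment:
  fixes A B :: "'n::finite \<Rightarrow> 'a::real_inner" and p :: "'n \<Rightarrow> real"
  assumes p: "\<And>i. 0 \<le> p i" "(\<Sum>i\<in>UNIV. p i) = 1" and \<delta>: "0 < \<delta>"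
  shows "(\<Sum>i\<in>UNIV. p i * (norm (A i - B i + (\<Sum>j\<in>UNIV. p j *\<^sub>R B j)))\<^sup>2)
    \<le> (1 + \<delta>) * (\<Sum>i\<in>UNIV. p i * (norm (A i))\<^sup>2) - \<delta> * (norm (\<Sum>j\<in>UNIV. p j *\<^sub>R A j))\<^sup>2
      + (1 + 1 / \<delta>) * (\<Sum>i\<in>UNIV. p i * (norm (B i))\<^sup>2)"
proof -
  define a b where "a = (\<Sum>j\<in>UNIV. p j *\<^sub>R A j)" and "b = (\<Sum>j\<in>UNIV. p j *\<^sub>R B j)"
  let ?X = "\<lambda>i. A i - B i"
  have m: "(\<Sum>j\<in>UNIV. p j *\<^sub>R ?X j) = a - b"
    by (simp add: a_def b_def scaleR_diff_right sum_subtractf)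
  have "(\<Sum>i\<in>UNIV. p i * (norm (A i - B i + b))\<^sup>2)
      = (\<Sum>i\<in>UNIV. p i * (norm (?X i - (a - b) + a))\<^sup>2)"
    by (simp add: algebra_simps)
  also have "\<dots> = (\<Sum>i\<in>UNIV. p i * (norm (?X i - (a - b) + 0))\<^sup>2) + (norm a)\<^sup>2"
    unfolding m[symmetric] weighted_variance[OF p(2)] by simp
  also have "(\<Sum>i\<in>UNIV. p i * (norm (?X i - (a - b) + 0))\<^sup>2)
      \<le> (\<Sum>i\<in>UNIV. p i * ((1 + \<delta>) * (norm (A i - a + 0))\<^sup>2 + (1 + 1 / \<delta>) * (norm (B i - b + 0))\<^sup>2))"
  proof (intro sum_mono mult_left_mono p(1))
    fix i
    show "(norm (?X i - (a - b) + 0))\<^sup>2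
        \<le> (1 + \<delta>) * (norm (A i - a + 0))\<^sup>2 + (1 + 1 / \<delta>) * (norm (B i - b + 0))\<^sup>2"
      using norm_diff_square_Young[OF \<delta>, of "A i - a" "B i - b"] by (simp add: algebra_simps)
  qed
  also have "\<dots> = (1 + \<delta>) * (\<Sum>i\<in>UNIV. p i * (norm (A i - a + 0))\<^sup>2)
      + (1 + 1 / \<delta>) * (\<Sum>i\<in>UNIV. p i * (norm (B i - b + 0))\<^sup>2)"
    by (simp only: sum.distrib sum_distrib_left distrib_left mult.left_commute)
  also have "\<dots> = (1 + \<delta>) * ((\<Sum>i\<in>UNIV. p i * (norm (A i))\<^sup>2) - (norm a)\<^sup>2)
      + (1 + 1 / \<delta>) * ((\<Sum>i\<in>UNIV. p i * (norm (B i))\<^sup>2) - (norm b)\<^sup>2)"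
    unfolding a_def b_def weighted_variance[OF p(2)] by simp
  also have "\<dots> \<le> (1 + \<delta>) * ((\<Sum>i\<in>UNIV. p i * (norm (A i))\<^sup>2) - (norm a)\<^sup>2)
      + (1 + 1 / \<delta>) * (\<Sum>i\<in>UNIV. p i * (norm (B i))\<^sup>2)"
    using \<delta> by (intro add_left_mono mult_left_mono) auto
  finally show ?thesis
    by (simp add: a_def b_def algebra_simps)
qed

section \<open>One iteration contracts the Lyapunov function\<close>

lemma nu_objective_ge:
  fixes L p \<eta> :: "'n::finite \<Rightarrow> real"
  shows "(1 + 1 / \<delta>) * (L i / (real CARD('n) * p i)) * (\<eta> i / (\<eta> i - \<rho>))
       + (1 + \<delta>) * (L i / (real CARD('n) * p i)) - \<delta> * \<mu> \<le> nu_objective \<mu> L p \<eta> \<rho> \<delta>"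
  unfolding nu_objective_def by (rule Max_ge) auto

text \<open>The algebra of the one-step estimate. Here \<open>e\<close> stands for \<open>x - xs\<close>, \<open>d i\<close> and \<open>b i\<close> for the errors of
\<open>\<nabla>f i x\<close> and of the stored gradient \<open>y i\<close> relative to \<open>\<nabla>f i xs\<close>, and \<open>D\<close> for the error of the full
gradient. The weights \<open>\<gamma>\<close> are chosen so that the \<open>b\<close>-terms are multiplied by exactly \<open>1 - \<rho>\<close>.
Cocoercivity turns each \<open>d\<close>-term into a multiple of \<open>\<langle>d i, e\<rangle>\<close>, whose coefficient is \<open>lam\<^sup>2 / n\<close> times
at most \<open>c + \<delta> \<mu>\<close> because \<open>c\<close> dominates the maximum that defines the objective. Summation gives
\<open>lam\<^sup>2 (c + \<delta> \<mu>) \<langle>D, e\<rangle>\<close>, and the part with \<open>\<delta> \<mu>\<close> is cancelled by \<open>- \<delta> \<parallel>D\<parallel>\<^sup>2\<close>. What remains is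
\<open>- lam (2 - c lam) \<langle>D, e\<rangle>\<close>, at most \<open>- \<rho> \<parallel>e\<parallel>\<^sup>2\<close> by strong monotonicity.\<close>

lemma lyapunov_drift:
  fixes d b :: "'n::finite \<Rightarrow> 'a::real_inner" and e D :: 'a and L p \<eta> :: "'n \<Rightarrow> real"
  defines "n \<equiv> real CARD('n)"
  defines "D \<equiv> (1 / n) *\<^sub>R (\<Sum>i\<in>UNIV. d i)"
  assumes p: "\<And>i. 0 < p i" and \<eta>: "\<And>i. 0 < \<eta> i" "\<And>i. \<rho> < \<eta> i"
    and L: "\<And>i. 0 < L i" and lam: "0 < lam" and \<delta>: "0 < \<delta>" and \<mu>: "0 < \<mu>"
    and coercive: "\<And>i. (norm (d i))\<^sup>2 \<le> L i * inner (d i) e"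
    and strong: "\<mu> * (norm e)\<^sup>2 \<le> inner D e"
    and c: "nu_objective \<mu> L p \<eta> \<rho> \<delta> \<le> c"
    and \<rho>: "0 \<le> \<rho>" "\<rho> \<le> \<mu> * lam * (2 - c * lam)"
    and \<gamma>: "\<And>i. \<gamma> i = lam\<^sup>2 / (n\<^sup>2 * p i) * (1 / (\<eta> i - \<rho>)) * (1 + 1 / \<delta>)"
  shows "(norm e)\<^sup>2 - 2 * lam * inner D e
      + lam\<^sup>2 * ((1 + \<delta>) * (\<Sum>i\<in>UNIV. (norm (d i))\<^sup>2 / (n\<^sup>2 * p i)) - \<delta> * (norm D)\<^sup>2
               + (1 + 1 / \<delta>) * (\<Sum>i\<in>UNIV. (norm (b i))\<^sup>2 / (n\<^sup>2 * p i)))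
      + (\<Sum>i\<in>UNIV. \<gamma> i * ((norm (b i))\<^sup>2 + \<eta> i * ((norm (d i))\<^sup>2 - (norm (b i))\<^sup>2)))
    \<le> (1 - \<rho>) * ((norm e)\<^sup>2 + (\<Sum>i\<in>UNIV. \<gamma> i * (norm (b i))\<^sup>2))"
proof -
  have n: "0 < n" by (simp add: n_def)
  let ?\<kappa> = "1 + 1 / \<delta>"
  let ?ib = "inner D e"
  have ib: "0 \<le> ?ib" using strong \<mu> by (smt (verit) mult_nonneg_nonneg zero_le_power2)
  \<comment> \<open>Cauchy-Schwarz combined with strong monotonicity: \<open>\<langle>D, e\<rangle>\<^sup>2 \<le> \<parallel>D\<parallel>\<^sup>2 \<parallel>e\<parallel>\<^sup>2 \<le> \<parallel>D\<parallel>\<^sup>2 \<langle>D, e\<rangle> / \<mu>\<close>.\<close>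
  have D_lower: "\<mu> * ?ib \<le> (norm D)\<^sup>2"
  proof (cases "e = 0")
    case False
    have "(\<mu> * ?ib) * (norm e)\<^sup>2 \<le> ?ib * ?ib"
      using mult_left_mono[OF strong ib] by (simp add: mult_ac)
    also have "\<dots> \<le> (norm D)\<^sup>2 * (norm e)\<^sup>2"
      using power_mono[OF norm_cauchy_schwarz[of D e] ib, of 2]
      by (simp add: power2_eq_square mult_ac)
    finally show ?thesis using False by simp
  qed simp
  have Ddi: "(\<Sum>i\<in>UNIV. inner (d i) e) = n * ?ib"
    using n by (simp add: D_def inner_sum_left)
  have summand: "lam\<^sup>2 * ((1 + \<delta>) * ((norm (d i))\<^sup>2 / (n\<^sup>2 * p i)) + ?\<kappa> * ((norm (b i))\<^sup>2 / (n\<^sup>2 * p i)))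
      + \<gamma> i * ((norm (b i))\<^sup>2 + \<eta> i * ((norm (d i))\<^sup>2 - (norm (b i))\<^sup>2))
    \<le> lam\<^sup>2 * ((c + \<delta> * \<mu>) / n) * inner (d i) e + (1 - \<rho>) * (\<gamma> i * (norm (b i))\<^sup>2)" for i
  proof -
    define t where "t = \<eta> i - \<rho>"
    define q where "q = lam\<^sup>2 / (n\<^sup>2 * p i)"
    have t: "0 < t" using \<eta>(2)[of i] by (simp add: t_def)
    have q: "0 < q" using lam n p[of i] by (simp add: q_def)
    have \<gamma>q: "\<gamma> i * t = q * ?\<kappa>" using t by (simp add: \<gamma> q_def t_def)
    define w where "w = (1 + \<delta>) + ?\<kappa> * (\<eta> i / t)"
    have w: "0 \<le> w" using \<delta> t \<eta>(1)[of i] by (simp add: w_def)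
    have inner_nonneg: "0 \<le> inner (d i) e"
      using coercive[of i] L[of i] by (smt (verit) mult_pos_neg zero_le_power2)
    have "\<gamma> i = q * ?\<kappa> / t" using \<gamma>q t by (simp add: field_simps)
    then have "q * (1 + \<delta>) * (norm (d i))\<^sup>2 + \<gamma> i * \<eta> i * (norm (d i))\<^sup>2 = q * w * (norm (d i))\<^sup>2"
      by (simp add: w_def algebra_simps add_divide_distrib)
    also have "\<dots> \<le> q * w * (L i * inner (d i) e)"
      using q w coercive[of i] by (intro mult_left_mono) auto
    also have "\<dots> = lam\<^sup>2 / n * (w * (L i / (n * p i))) * inner (d i) e"
      by (simp add: q_def power2_eq_square)
    also have "\<dots> \<le> lam\<^sup>2 / n * (c + \<delta> * \<mu>) * inner (d i) e"
    proof (intro mult_right_mono mult_left_mono inner_nonneg)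
      show "w * (L i / (n * p i)) \<le> c + \<delta> * \<mu>"
      proof -
        have "w * (L i / (n * p i))
            = ?\<kappa> * (L i / (n * p i)) * (\<eta> i / t) + (1 + \<delta>) * (L i / (n * p i))"
          unfolding w_def distrib_right by (simp only: mult_ac add.commute)
        then show ?thesis
          using nu_objective_ge[of \<delta> L i p \<eta> \<rho> \<mu>] c
          unfolding t_def n_def by linarith
      qed
    qed (use n in simp)
    finally have 1: "q * (1 + \<delta>) * (norm (d i))\<^sup>2 + \<gamma> i * \<eta> i * (norm (d i))\<^sup>2
        \<le> lam\<^sup>2 / n * (c + \<delta> * \<mu>) * inner (d i) e" .
    have 2: "q * ?\<kappa> * (norm (b i))\<^sup>2 + \<gamma> i * (1 - \<eta> i) * (norm (b i))\<^sup>2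
        = (1 - \<rho>) * (\<gamma> i * (norm (b i))\<^sup>2)"
      unfolding \<gamma>q[symmetric] t_def by (simp add: algebra_simps)
    have "lam\<^sup>2 * ((1 + \<delta>) * ((norm (d i))\<^sup>2 / (n\<^sup>2 * p i)) + ?\<kappa> * ((norm (b i))\<^sup>2 / (n\<^sup>2 * p i)))
      + \<gamma> i * ((norm (b i))\<^sup>2 + \<eta> i * ((norm (d i))\<^sup>2 - (norm (b i))\<^sup>2))
      = (q * (1 + \<delta>) * (norm (d i))\<^sup>2 + \<gamma> i * \<eta> i * (norm (d i))\<^sup>2)
      + (q * ?\<kappa> * (norm (b i))\<^sup>2 + \<gamma> i * (1 - \<eta> i) * (norm (b i))\<^sup>2)"
      unfolding q_def by (simp add: algebra_simps add_divide_distrib)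
    with 1 2 show ?thesis by (simp add: mult.assoc)
  qed
  have "lam\<^sup>2 * ((1 + \<delta>) * (\<Sum>i\<in>UNIV. (norm (d i))\<^sup>2 / (n\<^sup>2 * p i)) - \<delta> * (norm D)\<^sup>2
               + ?\<kappa> * (\<Sum>i\<in>UNIV. (norm (b i))\<^sup>2 / (n\<^sup>2 * p i)))
      + (\<Sum>i\<in>UNIV. \<gamma> i * ((norm (b i))\<^sup>2 + \<eta> i * ((norm (d i))\<^sup>2 - (norm (b i))\<^sup>2)))
    = (\<Sum>i\<in>UNIV. lam\<^sup>2 * ((1 + \<delta>) * ((norm (d i))\<^sup>2 / (n\<^sup>2 * p i)) + ?\<kappa> * ((norm (b i))\<^sup>2 / (n\<^sup>2 * p i)))
      + \<gamma> i * ((norm (b i))\<^sup>2 + \<eta> i * ((norm (d i))\<^sup>2 - (norm (b i))\<^sup>2)))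
      - lam\<^sup>2 * \<delta> * (norm D)\<^sup>2"
    by (simp only: sum.distrib sum_distrib_left distrib_left right_diff_distrib mult.assoc)
  also have "\<dots> \<le> (\<Sum>i\<in>UNIV. lam\<^sup>2 * ((c + \<delta> * \<mu>) / n) * inner (d i) e + (1 - \<rho>) * (\<gamma> i * (norm (b i))\<^sup>2))
      - lam\<^sup>2 * \<delta> * (\<mu> * ?ib)"
    using \<delta> D_lower by (intro diff_mono sum_mono summand mult_left_mono) auto
  also have "\<dots> = lam\<^sup>2 * ((c + \<delta> * \<mu>) / n) * (n * ?ib) + (1 - \<rho>) * (\<Sum>i\<in>UNIV. \<gamma> i * (norm (b i))\<^sup>2)
      - lam\<^sup>2 * \<delta> * (\<mu> * ?ib)"
    by (simp only: sum.distrib sum_distrib_left[symmetric] Ddi)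
  also have "\<dots> = lam\<^sup>2 * c * ?ib + (1 - \<rho>) * (\<Sum>i\<in>UNIV. \<gamma> i * (norm (b i))\<^sup>2)"
    using n by (simp add: field_simps)
  finally have 3: "lam\<^sup>2 * ((1 + \<delta>) * (\<Sum>i\<in>UNIV. (norm (d i))\<^sup>2 / (n\<^sup>2 * p i)) - \<delta> * (norm D)\<^sup>2
               + ?\<kappa> * (\<Sum>i\<in>UNIV. (norm (b i))\<^sup>2 / (n\<^sup>2 * p i)))
      + (\<Sum>i\<in>UNIV. \<gamma> i * ((norm (b i))\<^sup>2 + \<eta> i * ((norm (d i))\<^sup>2 - (norm (b i))\<^sup>2)))
    \<le> lam\<^sup>2 * c * ?ib + (1 - \<rho>) * (\<Sum>i\<in>UNIV. \<gamma> i * (norm (b i))\<^sup>2)" .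
  have step: "0 \<le> lam * (2 - c * lam)"
    using \<rho> \<mu> by (smt (verit) mult.assoc mult_pos_neg)
  have "\<rho> * (norm e)\<^sup>2 \<le> \<mu> * lam * (2 - c * lam) * (norm e)\<^sup>2"
    by (rule mult_right_mono[OF \<rho>(2)]) simp
  also have "\<dots> \<le> lam * (2 - c * lam) * ?ib"
    using mult_left_mono[OF strong step] by (simp add: mult_ac)
  finally show ?thesis
    using 3 by (simp add: algebra_simps power2_eq_square)
qed

definition pvrsg_step ::
  "real \<Rightarrow> ('a::real_inner \<Rightarrow> ereal) \<Rightarrow> ('n::finite \<Rightarrow> 'a \<Rightarrow> real) \<Rightarrow> ('n \<Rightarrow> real) \<Rightarrow>
   'n \<times> ('n \<Rightarrow> bool) \<Rightarrow> 'a \<times> ('n \<Rightarrow> 'a) \<Rightarrow> 'a \<times> ('n \<Rightarrow> 'a)" where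
  "pvrsg_step lam g f p = (\<lambda>(i, u) (x, y).
     (prox lam g (x - (lam / real CARD('n)) *\<^sub>R
        ((1 / p i) *\<^sub>R (grad (f i) x - y i) + (\<Sum>j\<in>UNIV. y j))),
      \<lambda>j. y j + of_bool (u j) *\<^sub>R (grad (f j) x - y j)))"

text \<open>The estimated gradient minus the full gradient at \<open>xs\<close> is \<open>G i = A i - B i + (mean of B)\<close>, where \<open>A i\<close> and
\<open>B i\<close> are \<open>d i\<close> and \<open>b i\<close> with the importance weight \<open>1 / (n p i)\<close>. Its mean is \<open>D\<close>, so the cross term
of the expanded square is \<open>\<langle>D, e\<rangle>\<close>, and the second-moment bound for control variates handles the rest.
Only the marginal laws of the sampled index and of the single update indicators enter, since the
Lyapunov function is a sum of a term in the former and terms in the latter.\<close>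

lemma (in prob_space) pvrsg_step_contraction:
  fixes g :: "'b::euclidean_space \<Rightarrow> ereal" and f :: "'n::finite \<Rightarrow> 'b \<Rightarrow> real"
    and W :: "'a \<Rightarrow> 'n \<times> ('n \<Rightarrow> bool)" and L p \<eta> :: "'n \<Rightarrow> real" and y ys :: "'n \<Rightarrow> 'b"
  assumes g: "closed_convex_proper g"
    and f: "\<And>i. smooth_fun (L i) (f i)" and F: "strongly_convex_fun \<mu> (avg_fun f)"
    and lam: "0 < lam"
    and ev: "\<And>w. {\<omega> \<in> space M. W \<omega> = w} \<in> events"
    and p: "\<And>i. prob {\<omega> \<in> space M. fst (W \<omega>) = i} = p i" "\<And>i. 0 < p i"
    and \<eta>: "\<And>i. expectation (\<lambda>\<omega>. of_bool (snd (W \<omega>) i)) = \<eta> i" "\<And>i. 0 < \<eta> i" "\<And>i. \<rho> < \<eta> i"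
    and xs: "is_arg_min (\<lambda>v. g v + ereal (avg_fun f v)) (\<lambda>_. True) xs"
    and ys: "\<And>i. ys i = grad (f i) xs"
    and \<delta>: "0 < \<delta>" and c: "nu_objective \<mu> L p \<eta> \<rho> \<delta> \<le> c"
    and \<rho>: "0 \<le> \<rho>" "\<rho> \<le> \<mu> * lam * (2 - c * lam)"
    and \<gamma>: "\<And>i. \<gamma> i = lam\<^sup>2 / ((real CARD('n))\<^sup>2 * p i) * (1 / (\<eta> i - \<rho>)) * (1 + 1 / \<delta>)"
  shows "expectation (\<lambda>\<omega>. case_prod (lyapunov \<gamma> xs ys) (pvrsg_step lam g f p (W \<omega>) (x, y)))
    \<le> (1 - \<rho>) * lyapunov \<gamma> xs ys x y"
proof -
  define n where "n = real CARD('n)"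
  have n: "0 < n" by (simp add: n_def)
  define e where "e = x - xs"
  define d where "d i = grad (f i) x - ys i" for i
  define b where "b i = y i - ys i" for i
  define D where "D = (1 / n) *\<^sub>R (\<Sum>i\<in>UNIV. d i)"
  define A where "A i = (1 / (n * p i)) *\<^sub>R d i" for i
  define B where "B i = (1 / (n * p i)) *\<^sub>R b i" for i
  define G where "G i = A i - B i + (\<Sum>j\<in>UNIV. p j *\<^sub>R B j)" for i
  have diff: "f i differentiable (at v)" for i v using f by (simp add: smooth_fun_def)
  have DF: "GDERIV (avg_fun f) v :> (1 / n) *\<^sub>R (\<Sum>i\<in>UNIV. grad (f i) v)" for v
    unfolding n_def by (rule GDERIV_avg_fun[OF diff])
  have Fdiff: "avg_fun f differentiable (at v)" for v
    using DF[of v] unfolding gderiv_def differentiable_def by blast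
  have L: "0 < L i" for i using f by (simp add: smooth_fun_def)
  have \<mu>: "0 < \<mu>" using F by (simp add: strongly_convex_fun_def)
  have coercive: "(norm (d i))\<^sup>2 \<le> L i * inner (d i) e" for i
  proof -
    have "1 / L i * (norm (d i))\<^sup>2 \<le> inner (d i) e"
      using f[of i] by (simp add: smooth_fun_def d_def e_def ys)
    then show ?thesis using L[of i] by (simp add: field_simps)
  qed
  have "D = grad (avg_fun f) x - grad (avg_fun f) xs"
    using grad_eqI[OF DF] by (simp add: D_def d_def ys sum_subtractf scaleR_diff_right)
  then have strong: "\<mu> * (norm e)\<^sup>2 \<le> inner D e"
    using strongly_convex_gradient_monotone[OF F Fdiff, of x xs] by (simp add: e_def)

  have pA: "(\<Sum>j\<in>UNIV. p j *\<^sub>R A j) = D" and pB: "(\<Sum>j\<in>UNIV. p j *\<^sub>R B j) = (1 / n) *\<^sub>R (\<Sum>j\<in>UNIV. b j)"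
    using p(2) by (simp_all add: A_def B_def D_def scaleR_sum_right less_imp_neq[symmetric])

  have evI: "{\<omega> \<in> space M. fst (W \<omega>) = i} \<in> events" for i
  proof -
    have "{\<omega> \<in> space M. fst (W \<omega>) = i} = (\<Union>u. {\<omega> \<in> space M. W \<omega> = (i, u)})"
      by (auto simp: prod_eq_iff)
    then show ?thesis using ev by (auto intro: sets.finite_UN)
  qed
  have expI: "expectation (\<lambda>\<omega>. h (fst (W \<omega>))) = (\<Sum>i\<in>UNIV. p i * h i)" for h :: "'n \<Rightarrow> real"
    using expectation_finite_range(2)[OF finite_class.finite_UNIV UNIV_I evI, of h] by (simp add: p(1))
  have intW: "integrable M (\<lambda>\<omega>. h (W \<omega>))" for h :: "'n \<times> ('n \<Rightarrow> bool) \<Rightarrow> real"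
    using expectation_finite_range(1)[OF finite_class.finite_UNIV UNIV_I ev, of h] .
  have psum: "(\<Sum>i\<in>UNIV. p i) = 1" using expI[of "\<lambda>_. 1"] by (simp add: prob_space)

  let ?h = "\<lambda>w. (norm (e - lam *\<^sub>R G (fst w)))\<^sup>2
     + (\<Sum>j\<in>UNIV. \<gamma> j * ((norm (b j))\<^sup>2 + of_bool (snd w j) * ((norm (d j))\<^sup>2 - (norm (b j))\<^sup>2)))"
  have second: "(\<Sum>i\<in>UNIV. p i * (norm (G i))\<^sup>2)
      \<le> (1 + \<delta>) * (\<Sum>i\<in>UNIV. (norm (d i))\<^sup>2 / (n\<^sup>2 * p i)) - \<delta> * (norm D)\<^sup>2
        + (1 + 1 / \<delta>) * (\<Sum>i\<in>UNIV. (norm (b i))\<^sup>2 / (n\<^sup>2 * p i))"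
  proof -
    have "p i * (norm (A i))\<^sup>2 = (norm (d i))\<^sup>2 / (n\<^sup>2 * p i)"
      and "p i * (norm (B i))\<^sup>2 = (norm (b i))\<^sup>2 / (n\<^sup>2 * p i)" for i
      using p(2)[of i] n by (simp_all add: A_def B_def power_divide power_mult_distrib power2_eq_square)
    then show ?thesis
      using control_variate_second_moment[of p \<delta> A B] p(2) psum \<delta>
      by (simp add: G_def pA less_imp_le)
  qed
  have "(\<Sum>i\<in>UNIV. p i * (norm (e - lam *\<^sub>R G i))\<^sup>2)
      = (norm e)\<^sup>2 - 2 * lam * inner D e + lam\<^sup>2 * (\<Sum>i\<in>UNIV. p i * (norm (G i))\<^sup>2)"
  proof -
    have "p i * (norm (e - lam *\<^sub>R G i))\<^sup>2
        = p i * (norm e)\<^sup>2 - 2 * lam * inner (p i *\<^sub>R G i) e + lam\<^sup>2 * (p i * (norm (G i))\<^sup>2)" for i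
      unfolding power2_norm_eq_inner
      by (simp add: inner_diff_left inner_diff_right inner_commute power2_eq_square algebra_simps)
    then have "(\<Sum>i\<in>UNIV. p i * (norm (e - lam *\<^sub>R G i))\<^sup>2)
        = (\<Sum>i\<in>UNIV. p i) * (norm e)\<^sup>2 - 2 * lam * inner (\<Sum>i\<in>UNIV. p i *\<^sub>R G i) e
          + lam\<^sup>2 * (\<Sum>i\<in>UNIV. p i * (norm (G i))\<^sup>2)"
      by (simp only: inner_sum_left sum.distrib sum_subtractf sum_distrib_left sum_distrib_right)
    moreover have "(\<Sum>i\<in>UNIV. p i *\<^sub>R G i) = D"
      by (simp add: G_def scaleR_add_right scaleR_diff_right sum.distrib sum_subtractf pA
          scaleR_left.sum[symmetric] psum)
    ultimately show ?thesis by (simp add: psum)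
  qed
  also have "\<dots> \<le> (norm e)\<^sup>2 - 2 * lam * inner D e
      + lam\<^sup>2 * ((1 + \<delta>) * (\<Sum>i\<in>UNIV. (norm (d i))\<^sup>2 / (n\<^sup>2 * p i)) - \<delta> * (norm D)\<^sup>2
               + (1 + 1 / \<delta>) * (\<Sum>i\<in>UNIV. (norm (b i))\<^sup>2 / (n\<^sup>2 * p i)))"
    using mult_left_mono[OF second, of "lam\<^sup>2"] by simp
  finally have mean: "(\<Sum>i\<in>UNIV. p i * (norm (e - lam *\<^sub>R G i))\<^sup>2) \<le> (norm e)\<^sup>2 - 2 * lam * inner D e
      + lam\<^sup>2 * ((1 + \<delta>) * (\<Sum>i\<in>UNIV. (norm (d i))\<^sup>2 / (n\<^sup>2 * p i)) - \<delta> * (norm D)\<^sup>2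
               + (1 + 1 / \<delta>) * (\<Sum>i\<in>UNIV. (norm (b i))\<^sup>2 / (n\<^sup>2 * p i)))" .

  have "case_prod (lyapunov \<gamma> xs ys) (pvrsg_step lam g f p w (x, y)) \<le> ?h w" for w
  proof -
    obtain i u where w: "w = (i, u)" by (cases w)
    let ?z = "x - (lam / n) *\<^sub>R ((1 / p i) *\<^sub>R (grad (f i) x - y i) + (\<Sum>j\<in>UNIV. y j))"
    have "norm (prox lam g ?z - xs) \<le> norm (?z + lam *\<^sub>R ((1 / n) *\<^sub>R (\<Sum>i\<in>UNIV. grad (f i) xs)) - xs)"
      by (rule proximal_step_distance[OF g lam DF xs])
    also have "?z + lam *\<^sub>R ((1 / n) *\<^sub>R (\<Sum>i\<in>UNIV. grad (f i) xs)) - xs = e - lam *\<^sub>R G i"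
    proof -
      have "G i = (1 / n) *\<^sub>R ((1 / p i) *\<^sub>R (d i - b i) + (\<Sum>j\<in>UNIV. b j))"
        unfolding G_def pB by (simp add: A_def B_def scaleR_diff_right scaleR_add_right)
      also have "d i - b i = grad (f i) x - y i" by (simp add: d_def b_def)
      also have "(\<Sum>j\<in>UNIV. b j) = (\<Sum>j\<in>UNIV. y j) - (\<Sum>j\<in>UNIV. grad (f j) xs)"
        by (simp add: b_def ys sum_subtractf)
      finally show ?thesis by (simp add: e_def scaleR_add_right scaleR_diff_right)
    qed
    finally have "(norm (prox lam g ?z - xs))\<^sup>2 \<le> (norm (e - lam *\<^sub>R G i))\<^sup>2"
      by (rule power_mono) simp
    moreover have "(norm (y j + of_bool (u j) *\<^sub>R (grad (f j) x - y j) - ys j))\<^sup>2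
        = (norm (b j))\<^sup>2 + of_bool (u j) * ((norm (d j))\<^sup>2 - (norm (b j))\<^sup>2)" for j
      by (cases "u j") (simp_all add: b_def d_def)
    ultimately show ?thesis
      by (simp add: w pvrsg_step_def lyapunov_def n_def)
  qed
  then have "expectation (\<lambda>\<omega>. case_prod (lyapunov \<gamma> xs ys) (pvrsg_step lam g f p (W \<omega>) (x, y)))
      \<le> expectation (\<lambda>\<omega>. ?h (W \<omega>))"
    by (intro integral_mono intW)
  also have "\<dots> = (\<Sum>i\<in>UNIV. p i * (norm (e - lam *\<^sub>R G i))\<^sup>2)
      + (\<Sum>j\<in>UNIV. \<gamma> j * ((norm (b j))\<^sup>2 + \<eta> j * ((norm (d j))\<^sup>2 - (norm (b j))\<^sup>2)))"
  proof -
    have int_u: "integrable M (\<lambda>\<omega>. of_bool (snd (W \<omega>) j) :: real)" for j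
      by (rule intW)
    have exp_u: "expectation (\<lambda>\<omega>. \<gamma> j * ((norm (b j))\<^sup>2 + of_bool (snd (W \<omega>) j) * ((norm (d j))\<^sup>2 - (norm (b j))\<^sup>2)))
        = \<gamma> j * ((norm (b j))\<^sup>2 + \<eta> j * ((norm (d j))\<^sup>2 - (norm (b j))\<^sup>2))" for j
      using int_u[of j] by (simp add: \<eta>(1) prob_space)
    show ?thesis
      by (subst Bochner_Integration.integral_add[OF intW intW],
          subst Bochner_Integration.integral_sum[OF intW])
         (simp only: exp_u expI[of "\<lambda>i. (norm (e - lam *\<^sub>R G i))\<^sup>2"])
  qed
  also note add_right_mono[OF mean]
  also have "(norm e)\<^sup>2 - 2 * lam * inner D e
      + lam\<^sup>2 * ((1 + \<delta>) * (\<Sum>i\<in>UNIV. (norm (d i))\<^sup>2 / (n\<^sup>2 * p i)) - \<delta> * (norm D)\<^sup>2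
               + (1 + 1 / \<delta>) * (\<Sum>i\<in>UNIV. (norm (b i))\<^sup>2 / (n\<^sup>2 * p i)))
      + (\<Sum>i\<in>UNIV. \<gamma> i * ((norm (b i))\<^sup>2 + \<eta> i * ((norm (d i))\<^sup>2 - (norm (b i))\<^sup>2)))
    \<le> (1 - \<rho>) * ((norm e)\<^sup>2 + (\<Sum>i\<in>UNIV. \<gamma> i * (norm (b i))\<^sup>2))"
    unfolding D_def n_def
    by (rule lyapunov_drift[OF p(2) \<eta>(2,3) L lam \<delta> \<mu> coercive strong[unfolded D_def n_def] c \<rho> \<gamma>])
  finally show ?thesis
    by (simp only: lyapunov_def[of \<gamma> xs ys x y] e_def b_def)
qed

section \<open>The objective defining the step-size constant\<close>

lemma continuous_on_Max:
  fixes f :: "'i \<Rightarrow> 'a::topological_space \<Rightarrow> 'b::linorder_topology"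
  assumes "finite A" "A \<noteq> {}" "\<And>i. i \<in> A \<Longrightarrow> continuous_on S (f i)"
  shows "continuous_on S (\<lambda>x. MAX i\<in>A. f i x)"
  using assms
proof (induction rule: finite_ne_induct)
  case (insert i A)
  have "(MAX j\<in>insert i A. f j x) = max (f i x) (MAX j\<in>A. f j x)" for x
    using insert.hyps by (simp add: image_insert)
  then show ?case using insert by (simp add: continuous_on_max)
qed simp

text \<open>Each term \<open>\<alpha>/\<delta> + \<beta> \<delta> + \<kappa>\<close> is strictly convex on the positive reals and tends to infinity at \<open>0\<close>; the
term with \<open>\<beta> > 0\<close> also does so at infinity. Hence the maximum attains its infimum on a compact interval
\<open>{a..b}\<close>, and at the midpoint of two distinct minimizers every single term would lie below the minimum.\<close>

lemma ex1_min_max_hyperbolic: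
  fixes \<alpha> \<beta> \<kappa> :: "'n::finite \<Rightarrow> real"
  defines "\<phi> \<equiv> (\<lambda>\<delta>. MAX i. \<alpha> i / \<delta> + \<beta> i * \<delta> + \<kappa> i)"
  assumes \<alpha>: "\<And>i. 0 < \<alpha> i" and \<beta>: "0 < \<beta> i0"
  shows "\<exists>!\<delta>. is_arg_min \<phi> (\<lambda>\<delta>. 0 < \<delta>) \<delta>"
proof -
  let ?t = "\<lambda>i \<delta>. \<alpha> i / \<delta> + \<beta> i * \<delta> + \<kappa> i"
  have \<phi>_eq: "\<phi> \<delta> = (MAX i. ?t i \<delta>)" for \<delta>
    by (simp add: \<phi>_def)
  have le: "?t i \<delta> \<le> \<phi> \<delta>" for i \<delta>
    unfolding \<phi>_def by (rule Max_ge) auto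
  \<comment> \<open>Outside \<open>{a..b}\<close> one of the two unbounded parts of the \<open>i0\<close>-th term exceeds \<open>r\<close>, which lifts \<open>\<phi>\<close> above \<open>\<phi> 1\<close>.\<close>
  define r where "r = \<bar>\<phi> 1 - \<kappa> i0\<bar> + 1"
  define a where "a = min 1 (\<alpha> i0 / r)"
  define b where "b = max 1 (r / \<beta> i0)"
  have r: "0 < r" by (simp add: r_def add_nonneg_pos)
  have a: "0 < a" using \<alpha>[of i0] r by (simp add: a_def)
  have outside: "\<phi> 1 < \<phi> \<delta>" if \<delta>: "0 < \<delta>" "\<delta> \<notin> {a..b}" for \<delta>
  proof -
    have "r < \<alpha> i0 / \<delta> + \<beta> i0 * \<delta>"
    proof (cases "\<delta> < a")
      case True
      then have "\<delta> < \<alpha> i0 / r" by (simp add: a_def)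
      then have "r < \<alpha> i0 / \<delta>" using \<delta> r by (simp add: field_simps)
      moreover have "0 < \<beta> i0 * \<delta>" using \<beta> \<delta> by simp
      ultimately show ?thesis by linarith
    next
      case False
      then have "r / \<beta> i0 < \<delta>" using \<delta> by (auto simp: b_def)
      then have "r < \<beta> i0 * \<delta>" using \<beta> by (simp add: field_simps)
      moreover have "0 < \<alpha> i0 / \<delta>" using \<alpha> \<delta> by simp
      ultimately show ?thesis by linarith
    qed
    moreover have "\<phi> 1 - \<kappa> i0 < r" by (simp add: r_def abs_if)
    ultimately show ?thesis using le[of i0 \<delta>] by linarith
  qed
  have "continuous_on {a..b} \<phi>"
    unfolding \<phi>_def using a by (intro continuous_on_Max continuous_intros) auto
  moreover have one: "1 \<in> {a..b}" by (simp add: a_def b_def)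
  ultimately obtain m where m: "m \<in> {a..b}" "\<forall>\<delta>\<in>{a..b}. \<phi> m \<le> \<phi> \<delta>"
    using continuous_attains_inf[of "{a..b}" \<phi>] by auto
  have min: "\<phi> m \<le> \<phi> \<delta>" if "0 < \<delta>" for \<delta>
    using m(2) one outside[OF that] by (cases "\<delta> \<in> {a..b}") fastforce+
  show ?thesis
  proof (rule ex1I)
    show "is_arg_min \<phi> (\<lambda>\<delta>. 0 < \<delta>) m"
      using min a m(1) by (auto simp: is_arg_min_linorder)
  next
    fix \<delta> assume "is_arg_min \<phi> (\<lambda>\<delta>. 0 < \<delta>) \<delta>"
    then have \<delta>: "0 < \<delta>" "\<phi> \<delta> \<le> \<phi> m"
      using a m(1) by (auto simp: is_arg_min_linorder)
    have m0: "0 < m" using a m(1) by simp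
    show "\<delta> = m"
    proof (rule ccontr)
      assume ne: "\<delta> \<noteq> m"
      have "?t i ((\<delta> + m) / 2) < \<phi> m" for i
      proof -
        have "0 < (\<delta> - m)\<^sup>2" using ne by simp
        then have "4 * (\<delta> * m) < (\<delta> + m) * (\<delta> + m)"
          by (simp add: power2_eq_square algebra_simps)
        then have "1 / ((\<delta> + m) / 2) < (1 / \<delta> + 1 / m) / 2"
          using \<delta>(1) m0 by (simp add: field_simps)
        then have "\<alpha> i * (1 / ((\<delta> + m) / 2)) < \<alpha> i * ((1 / \<delta> + 1 / m) / 2)"
          using \<alpha> by (rule mult_strict_left_mono)
        then have "?t i ((\<delta> + m) / 2) < (?t i \<delta> + ?t i m) / 2"
          by (simp add: algebra_simps add_divide_distrib)
        then show ?thesis using le[of i \<delta>] le[of i m] \<delta>(2) by simp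
      qed
      then have "\<phi> ((\<delta> + m) / 2) < \<phi> m"
        unfolding \<phi>_eq[of "(\<delta> + m) / 2"] by (subst Max_less_iff) auto
      then show False using min[of "(\<delta> + m) / 2"] \<delta>(1) m0 by simp
    qed
  qed
qed

lemma nu_objective_ex1_min:
  fixes L p \<eta> :: "'n::finite \<Rightarrow> real"
  assumes "\<And>i. 0 < L i" "\<And>i. 0 < p i" "\<And>i. 0 < \<eta> i" "\<And>i. \<rho> < \<eta> i"
    and "\<mu> < (MAX i. L i / (real CARD('n) * p i))"
  shows "\<exists>!\<delta>. is_arg_min (nu_objective \<mu> L p \<eta> \<rho>) (\<lambda>\<delta>. 0 < \<delta>) \<delta>"
proof -
  define a where "a i = L i / (real CARD('n) * p i)" for i
  define e where "e i = \<eta> i / (\<eta> i - \<rho>)" for i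
  have "(1 + 1 / \<delta>) * a i * e i + (1 + \<delta>) * a i - \<delta> * \<mu>
      = a i * e i / \<delta> + (a i - \<mu>) * \<delta> + (a i * e i + a i)" for \<delta> i
    by (simp add: algebra_simps)
  then have obj: "nu_objective \<mu> L p \<eta> \<rho> = (\<lambda>\<delta>. MAX i. a i * e i / \<delta> + (a i - \<mu>) * \<delta> + (a i * e i + a i))"
    unfolding nu_objective_def a_def e_def by simp
  have "(MAX i. a i) \<in> range a" by (rule Max_in) auto
  then obtain i0 where "(MAX i. a i) = a i0" by (rule imageE)
  then have "0 < a i0 - \<mu>" using assms(5) by (simp add: a_def)
  moreover have "0 < a i * e i" for i
    using assms by (simp add: a_def e_def)
  ultimately show ?thesis unfolding obj by (intro ex1_min_max_hyperbolic)
qed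

text \<open>If the largest \<open>L i / (n p i)\<close> equals \<open>\<mu>\<close>, nothing in the objective grows with \<open>\<delta>\<close>, and it is at most
\<open>\<mu> + \<mu> (1 + 1/\<delta>) e\<close>, where \<open>e\<close> is the largest \<open>\<eta> i / (\<eta> i - \<rho>')\<close>. This bound falls to
\<open>\<mu> + \<mu> e\<close> only in the limit of large \<open>\<delta>\<close>. Since \<open>e\<close> is strictly increasing in the rate, passing from \<open>\<rho>\<close> to \<open>\<rho>' < \<rho>\<close> leaves
room for a finite \<open>\<delta>\<close>.\<close>

lemma nu_objective_le_limit:
  fixes L p \<eta> :: "'n::finite \<Rightarrow> real"
  assumes "\<And>i. 0 < \<eta> i" "\<And>i. \<rho> < \<eta> i" "\<rho>' < \<rho>" "0 < \<mu>"
    and max: "(MAX i. L i / (real CARD('n) * p i)) = \<mu>"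
  obtains \<delta> where "0 < \<delta>"
    "nu_objective \<mu> L p \<eta> \<rho>' \<delta> \<le> \<mu> + \<mu> * (MAX i. \<eta> i / (\<eta> i - \<rho>))"
proof -
  define e where "e r = (MAX i. \<eta> i / (\<eta> i - r))" for r
  have e_ge: "\<eta> i / (\<eta> i - r) \<le> e r" for i r
    unfolding e_def by (rule Max_ge) auto
  have pos: "0 < \<eta> i / (\<eta> i - \<rho>')" for i
    using assms(1-3) by (smt (verit) divide_pos_pos)
  have "\<eta> i / (\<eta> i - \<rho>') < e \<rho>" for i
  proof -
    have "\<eta> i / (\<eta> i - \<rho>') < \<eta> i / (\<eta> i - \<rho>)"
      using assms(1-3) by (intro divide_strict_left_mono mult_pos_pos) (auto simp: less_trans)
    then show ?thesis using e_ge[of i \<rho>] by linarith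
  qed
  then have less: "e \<rho>' < e \<rho>" unfolding e_def[of \<rho>'] by (subst Max_less_iff) auto
  have e': "0 < e \<rho>'" using pos e_ge less_le_trans by blast
  \<comment> \<open>The value that solves \<open>(1 + 1/\<delta>) e \<rho>' = e \<rho>\<close>.\<close>
  define \<delta> where "\<delta> = e \<rho>' / (e \<rho> - e \<rho>')"
  have \<delta>: "0 < \<delta>" "(1 + 1 / \<delta>) * e \<rho>' = e \<rho>"
    using less e' by (simp_all add: \<delta>_def field_simps)
  have "(1 + 1 / \<delta>) * a * (\<eta> i / (\<eta> i - \<rho>')) + (1 + \<delta>) * a - \<delta> * \<mu> \<le> \<mu> + \<mu> * e \<rho>"
    if a: "a = L i / (real CARD('n) * p i)" for a i
  proof -
    have "a \<le> \<mu>" unfolding a max[symmetric] by (rule Max_ge) auto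
    have "(1 + 1 / \<delta>) * (a * (\<eta> i / (\<eta> i - \<rho>'))) \<le> (1 + 1 / \<delta>) * (\<mu> * e \<rho>')"
      using \<open>a \<le> \<mu>\<close> \<delta>(1) assms(4) pos[of i] e_ge[of i \<rho>']
      by (intro mult_left_mono mult_mono) auto
    also have "\<dots> = \<mu> * e \<rho>" using \<delta>(2) by (metis mult.left_commute)
    finally have "(1 + 1 / \<delta>) * a * (\<eta> i / (\<eta> i - \<rho>')) \<le> \<mu> * e \<rho>" by (simp only: mult.assoc)
    moreover have "(1 + \<delta>) * a \<le> (1 + \<delta>) * \<mu>" using \<open>a \<le> \<mu>\<close> \<delta>(1) by (intro mult_left_mono) auto
    ultimately show ?thesis by (simp add: distrib_right)
  qed
  then have "nu_objective \<mu> L p \<eta> \<rho>' \<delta> \<le> \<mu> + \<mu> * e \<rho>"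
    unfolding nu_objective_def by (intro Max.boundedI) auto
  with \<delta>(1) show thesis using that by (simp add: e_def)
qed

section \<open>Convergence rate\<close>

lemma lyapunov_mono:
  assumes "\<And>i. \<gamma> i \<le> \<gamma>' i"
  shows "lyapunov \<gamma> xs ys x y \<le> lyapunov \<gamma>' xs ys x y"
  unfolding lyapunov_def by (intro add_left_mono sum_mono mult_right_mono assms) simp

lemma bigo_of_geometric_bound:
  fixes E :: "nat \<Rightarrow> real"
  assumes "\<And>k. 0 \<le> E k" "\<And>k. E k \<le> c ^ k * C" "0 \<le> c"
  shows "E \<in> O(\<lambda>k. c ^ k)"
  using assms by (intro bigoI[of _ C] always_eventually) (simp add: mult.commute)

theorem theorem4p1:
  fixes g :: "real ^ 'N \<Rightarrow> ereal"
    and f :: "'n::finite \<Rightarrow> real ^ 'N \<Rightarrow> real"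
    and L p \<eta> :: "'n \<Rightarrow> real" and LF \<mu> lam :: real
    and x0 xs :: "real ^ 'N" and y0 ys :: "'n \<Rightarrow> real ^ 'N"
    and M :: "'w measure"
    and I :: "nat \<Rightarrow> 'w \<Rightarrow> 'n" and U :: "nat \<Rightarrow> 'w \<Rightarrow> 'n \<Rightarrow> bool"
    and x :: "nat \<Rightarrow> 'w \<Rightarrow> real ^ 'N" and y :: "nat \<Rightarrow> 'w \<Rightarrow> 'n \<Rightarrow> real ^ 'N"
  assumes g: "closed_convex_proper g"
    and f: "\<And>i. convex_on UNIV (f i)" "\<And>i. smooth_fun (L i) (f i)"
    and F: "strongly_convex_fun \<mu> (avg_fun f)" "smooth_fun LF (avg_fun f)"
      "LF \<le> 1 / real CARD('n) * (\<Sum>i\<in>UNIV. L i)"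
    and step: "0 < lam"
    and prob: "prob_space M"
    and indep: "prob_space.indep_vars M (\<lambda>_. count_space UNIV) (\<lambda>k \<omega>. (I k \<omega>, U k \<omega>)) UNIV"
    and ident: "\<And>k. distr M (count_space UNIV) (\<lambda>\<omega>. (I k \<omega>, U k \<omega>)) =
                     distr M (count_space UNIV) (\<lambda>\<omega>. (I 0 \<omega>, U 0 \<omega>))"
    and p: "\<And>k i. measure M {\<omega> \<in> space M. I k \<omega> = i} = p i" "\<And>i. 0 < p i"
    and \<eta>: "\<And>k i. integral\<^sup>L M (\<lambda>\<omega>. of_bool (U k \<omega> i)) = \<eta> i" "\<And>i. 0 < \<eta> i"
    and iter: "\<And>\<omega>. \<omega> \<in> space M \<Longrightarrow>
       pvrsg_iterates lam g f p x0 y0 (\<lambda>k. I k \<omega>) (\<lambda>k. U k \<omega>) (\<lambda>k. x k \<omega>) (\<lambda>k. y k \<omega>)"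
    and xs: "xs = arg_min (\<lambda>v. g v + ereal (avg_fun f v)) (\<lambda>_. True)"
    and ys: "\<And>i. ys i = grad (f i) xs"
  shows
    "((MAX i. L i / (real CARD('n) * p i)) > \<mu> \<longrightarrow>
       (\<forall>\<rho> \<nu>. 0 < \<rho> \<and> \<rho> < (MIN i. \<eta> i) \<and>
          \<rho> = \<mu> * lam * (2 - \<nu> * lam) \<and>
          \<nu> = (INF \<delta>\<in>{0<..}. nu_objective \<mu> L p \<eta> \<rho> \<delta>) \<longrightarrow>
          (\<exists>!\<delta>. is_arg_min (nu_objective \<mu> L p \<eta> \<rho>) (\<lambda>\<delta>. 0 < \<delta>) \<delta>) \<and>
          (\<forall>\<delta>. is_arg_min (nu_objective \<mu> L p \<eta> \<rho>) (\<lambda>\<delta>. 0 < \<delta>) \<delta> \<longrightarrow>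
             (let \<gamma> = (\<lambda>i. lam\<^sup>2 / ((real CARD('n))\<^sup>2 * p i) * (1 / (\<eta> i - \<rho>)) * (1 + 1 / \<delta>));
                  V = (\<lambda>k \<omega>. lyapunov \<gamma> xs ys (x k \<omega>) (y k \<omega>))
              in (\<forall>k. integrable M (V k)) \<and>
                 (\<lambda>k. integral\<^sup>L M (V k)) \<in> O(\<lambda>k. (1 - \<rho>) ^ k))))) \<and>
     ((MAX i. L i / (real CARD('n) * p i)) = \<mu> \<longrightarrow>
       (\<forall>\<rho> \<nu>. 0 < \<rho> \<and> \<rho> < (MIN i. \<eta> i) \<and>
          \<rho> = \<mu> * lam * (2 - \<nu> * lam) \<and>
          \<nu> = \<mu> + \<mu> * (MAX i. \<eta> i / (\<eta> i - \<rho>)) \<longrightarrow>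
          (\<forall>\<rho>'. 0 < \<rho>' \<and> \<rho>' < \<rho> \<longrightarrow>
             (let \<gamma> = (\<lambda>i. lam\<^sup>2 / ((real CARD('n))\<^sup>2 * p i) * (1 / (\<eta> i - \<rho>')));
                  V = (\<lambda>k \<omega>. lyapunov \<gamma> xs ys (x k \<omega>) (y k \<omega>))
              in (\<forall>k. integrable M (V k)) \<and>
                 (\<lambda>k. integral\<^sup>L M (V k)) \<in> O(\<lambda>k. (1 - \<rho>') ^ k)))))"
proof -
  interpret prob_space M by (rule prob)
  define W where "W k \<omega> = (I k \<omega>, U k \<omega>)" for k \<omega>
  define S where "S k \<omega> = (x k \<omega>, y k \<omega>)" for k \<omega>
  have indepW: "indep_vars (\<lambda>_. count_space UNIV) W UNIV"
    using indep by (simp add: W_def[abs_def])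
  have S0: "S 0 \<omega> = (x0, y0)" if "\<omega> \<in> space M" for \<omega>
    using iter[OF that] by (simp add: S_def pvrsg_iterates_def)
  have SSuc: "S (Suc k) \<omega> = pvrsg_step lam g f p (W k \<omega>) (S k \<omega>)" if "\<omega> \<in> space M" for k \<omega>
    using iter[OF that] by (simp add: S_def W_def pvrsg_iterates_def pvrsg_step_def fun_eq_iff)

  have L: "0 < L i" for i using f(2) by (simp add: smooth_fun_def)
  have \<mu>: "0 < \<mu>" using F(1) by (simp add: strongly_convex_fun_def)
  have "\<exists>v. is_arg_min (\<lambda>v. g v + ereal (avg_fun f v)) (\<lambda>_. True) v"
    using F(2) by (intro ex_minimizer_strongly_convex[OF g F(1)]) (simp add: smooth_fun_def)
  then have min: "is_arg_min (\<lambda>v. g v + ereal (avg_fun f v)) (\<lambda>_. True) xs"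
    unfolding xs arg_min_def by (rule someI_ex)
  have \<eta>1: "\<eta> i \<le> 1" for i
  proof -
    have "integrable M (\<lambda>\<omega>. of_bool (U 0 \<omega> i) :: real)"
      using expectation_finite_range(1)[OF finite_class.finite_UNIV UNIV_I indep_vars_event[OF indepW],
          of "\<lambda>w. of_bool (snd w i)" 0] by (simp add: W_def)
    then have "expectation (\<lambda>\<omega>. of_bool (U 0 \<omega> i)) \<le> expectation (\<lambda>\<omega>. 1 :: real)"
      by (intro integral_mono) auto
    then show ?thesis by (simp add: \<eta>(1) prob_space)
  qed
  have integrable: "integrable M (\<lambda>\<omega>. lyapunov \<gamma> xs ys (x k \<omega>) (y k \<omega>))" for \<gamma> k
    using random_iteration_expectation(1)[OF indepW S0 SSuc, of "case_prod (lyapunov \<gamma> xs ys)" k]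
    by (simp add: S_def)

  have \<rho>1: "0 \<le> 1 - \<rho>" if "\<rho> < (MIN i. \<eta> i)" for \<rho>
  proof -
    have "\<rho> < \<eta> undefined" using that by simp
    then show ?thesis using \<eta>1[of undefined] by linarith
  qed

  \<comment> \<open>Both parts are instances with \<open>c = \<nu>\<close>: the first at the minimizing \<open>\<delta>\<close>, the second at a large \<open>\<delta>\<close> and the smaller rate.\<close>
  have rate: "expectation (\<lambda>\<omega>. lyapunov \<gamma> xs ys (x k \<omega>) (y k \<omega>)) \<le> (1 - \<rho>) ^ k * lyapunov \<gamma> xs ys x0 y0"
    if \<rho>: "0 < \<rho>" "\<rho> < (MIN i. \<eta> i)" "\<rho> \<le> \<mu> * lam * (2 - c * lam)"
      and \<delta>: "0 < \<delta>" "nu_objective \<mu> L p \<eta> \<rho> \<delta> \<le> c"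
      and \<gamma>: "\<gamma> = (\<lambda>i. lam\<^sup>2 / ((real CARD('n))\<^sup>2 * p i) * (1 / (\<eta> i - \<rho>)) * (1 + 1 / \<delta>))"
    for \<rho> c \<delta> \<gamma> k
  proof -
    have \<rho>\<eta>: "\<rho> < \<eta> i" for i using \<rho>(2) by simp
    have "expectation (\<lambda>\<omega>. case_prod (lyapunov \<gamma> xs ys) (pvrsg_step lam g f p (W k \<omega>) s))
        \<le> (1 - \<rho>) * case_prod (lyapunov \<gamma> xs ys) s" for k s
    proof -
      obtain u v where s: "s = (u, v)" by (cases s)
      show ?thesis
        unfolding s prod.case
        by (rule pvrsg_step_contraction[OF g f(2) F(1) step indep_vars_event[OF indepW] _ p(2) _ \<eta>(2)
              \<rho>\<eta> min ys \<delta> less_imp_le[OF \<rho>(1)] \<rho>(3)]) (simp_all add: W_def p(1) \<eta>(1) \<gamma>)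
    qed
    moreover note \<rho>1[OF \<rho>(2)]
    ultimately have "expectation (\<lambda>\<omega>. case_prod (lyapunov \<gamma> xs ys) (S k \<omega>))
        \<le> (1 - \<rho>) ^ k * case_prod (lyapunov \<gamma> xs ys) (x0, y0)"
      by (intro random_iteration_contraction[OF indepW S0 SSuc])
    then show ?thesis by (simp add: S_def)
  qed
  have nonneg: "0 \<le> expectation (\<lambda>\<omega>. lyapunov \<gamma> xs ys (x k \<omega>) (y k \<omega>))" if "\<And>i. 0 \<le> \<gamma> i" for \<gamma> k
    using that by (intro integral_nonneg_AE AE_I2) (auto simp: lyapunov_def intro!: add_nonneg_nonneg sum_nonneg)
  show ?thesis
  proof (intro conjI impI allI; elim conjE)
    fix \<rho> \<nu>
    assume max: "\<mu> < (MAX i. L i / (real CARD('n) * p i))"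
      and \<rho>: "0 < \<rho>" "\<rho> < (MIN i. \<eta> i)" "\<rho> = \<mu> * lam * (2 - \<nu> * lam)"
      and \<nu>: "\<nu> = (INF \<delta>\<in>{0<..}. nu_objective \<mu> L p \<eta> \<rho> \<delta>)"
    show "\<exists>!\<delta>. is_arg_min (nu_objective \<mu> L p \<eta> \<rho>) (\<lambda>\<delta>. 0 < \<delta>) \<delta>"
      using \<rho>(2) by (intro nu_objective_ex1_min L p(2) \<eta>(2) max) simp
  next
    fix \<rho> \<nu> \<delta>
    assume \<rho>: "0 < \<rho>" "\<rho> < (MIN i. \<eta> i)" "\<rho> = \<mu> * lam * (2 - \<nu> * lam)"
      and \<nu>: "\<nu> = (INF \<delta>\<in>{0<..}. nu_objective \<mu> L p \<eta> \<rho> \<delta>)"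
      and \<delta>_min: "is_arg_min (nu_objective \<mu> L p \<eta> \<rho>) (\<lambda>\<delta>. 0 < \<delta>) \<delta>"
    from \<delta>_min have \<delta>: "0 < \<delta>"
      and \<delta>min: "\<And>\<delta>'. 0 < \<delta>' \<Longrightarrow> nu_objective \<mu> L p \<eta> \<rho> \<delta> \<le> nu_objective \<mu> L p \<eta> \<rho> \<delta>'"
      by (auto simp: is_arg_min_linorder)
    have obj: "nu_objective \<mu> L p \<eta> \<rho> \<delta> \<le> \<nu>"
      unfolding \<nu> using \<delta>min by (intro cINF_greatest) auto
    define \<gamma> where "\<gamma> = (\<lambda>i. lam\<^sup>2 / ((real CARD('n))\<^sup>2 * p i) * (1 / (\<eta> i - \<rho>)) * (1 + 1 / \<delta>))"
    have "0 \<le> \<gamma> i" for i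
      using \<rho>(2) p(2)[of i] \<delta> by (simp add: \<gamma>_def less_imp_le)
    then have "(\<lambda>k. expectation (\<lambda>\<omega>. lyapunov \<gamma> xs ys (x k \<omega>) (y k \<omega>))) \<in> O(\<lambda>k. (1 - \<rho>) ^ k)"
      by (rule bigo_of_geometric_bound[OF nonneg
            rate[OF \<rho>(1,2) eq_refl[OF \<rho>(3)] \<delta> obj \<gamma>_def] \<rho>1[OF \<rho>(2)]])
    then show "let \<gamma> = \<lambda>i. lam\<^sup>2 / ((real CARD('n))\<^sup>2 * p i) * (1 / (\<eta> i - \<rho>)) * (1 + 1 / \<delta>);
                   V = \<lambda>k \<omega>. lyapunov \<gamma> xs ys (x k \<omega>) (y k \<omega>)
               in (\<forall>k. integrable M (V k)) \<and> (\<lambda>k. integral\<^sup>L M (V k)) \<in> O(\<lambda>k. (1 - \<rho>) ^ k)"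
      using integrable by (simp add: \<gamma>_def Let_def)
  next
    fix \<rho> \<nu> \<rho>'
    assume max: "(MAX i. L i / (real CARD('n) * p i)) = \<mu>"
      and \<rho>: "0 < \<rho>" "\<rho> < (MIN i. \<eta> i)" "\<rho> = \<mu> * lam * (2 - \<nu> * lam)"
      and \<nu>: "\<nu> = \<mu> + \<mu> * (MAX i. \<eta> i / (\<eta> i - \<rho>))"
      and \<rho>': "0 < \<rho>'" "\<rho>' < \<rho>"
    have \<rho>\<eta>: "\<rho> < \<eta> i" for i using \<rho>(2) by simp
    obtain \<delta> where \<delta>: "0 < \<delta>" "nu_objective \<mu> L p \<eta> \<rho>' \<delta> \<le> \<nu>"
      unfolding \<nu> by (rule nu_objective_le_limit[OF \<eta>(2) \<rho>\<eta> \<rho>'(2) \<mu> max])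
    have min': "\<rho>' < (MIN i. \<eta> i)" by (rule less_trans[OF \<rho>'(2) \<rho>(2)])
    then have \<rho>'\<eta>: "\<rho>' < \<eta> i" for i by simp
    define \<gamma> where "\<gamma> = (\<lambda>i. lam\<^sup>2 / ((real CARD('n))\<^sup>2 * p i) * (1 / (\<eta> i - \<rho>')))"
    define \<gamma>' where "\<gamma>' = (\<lambda>i. lam\<^sup>2 / ((real CARD('n))\<^sup>2 * p i) * (1 / (\<eta> i - \<rho>')) * (1 + 1 / \<delta>))"
    have \<gamma>0: "0 \<le> \<gamma> i" for i
      using \<rho>'\<eta>[of i] p(2)[of i] by (simp add: \<gamma>_def)
    have "\<gamma> i \<le> \<gamma>' i" for i
      using mult_left_mono[OF _ \<gamma>0[of i], of 1 "1 + 1 / \<delta>"] \<delta>(1) by (simp add: \<gamma>_def \<gamma>'_def)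
    then have "expectation (\<lambda>\<omega>. lyapunov \<gamma> xs ys (x k \<omega>) (y k \<omega>))
        \<le> expectation (\<lambda>\<omega>. lyapunov \<gamma>' xs ys (x k \<omega>) (y k \<omega>))" for k
      by (intro integral_mono integrable lyapunov_mono)
    moreover have "expectation (\<lambda>\<omega>. lyapunov \<gamma>' xs ys (x k \<omega>) (y k \<omega>)) \<le> (1 - \<rho>') ^ k * lyapunov \<gamma>' xs ys x0 y0" for k
      using \<rho>'(2) \<rho>(3) by (intro rate[OF \<rho>'(1) min' _ \<delta> \<gamma>'_def]) linarith
    ultimately have "expectation (\<lambda>\<omega>. lyapunov \<gamma> xs ys (x k \<omega>) (y k \<omega>))
        \<le> (1 - \<rho>') ^ k * lyapunov \<gamma>' xs ys x0 y0" for k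
      by (rule order_trans)
    then have "(\<lambda>k. expectation (\<lambda>\<omega>. lyapunov \<gamma> xs ys (x k \<omega>) (y k \<omega>))) \<in> O(\<lambda>k. (1 - \<rho>') ^ k)"
      by (intro bigo_of_geometric_bound nonneg \<gamma>0 \<rho>1 min')
    then show "let \<gamma> = \<lambda>i. lam\<^sup>2 / ((real CARD('n))\<^sup>2 * p i) * (1 / (\<eta> i - \<rho>'));
                   V = \<lambda>k \<omega>. lyapunov \<gamma> xs ys (x k \<omega>) (y k \<omega>)
               in (\<forall>k. integrable M (V k)) \<and> (\<lambda>k. integral\<^sup>L M (V k)) \<in> O(\<lambda>k. (1 - \<rho>') ^ k)"
      using integrable by (simp add: \<gamma>_def Let_def)
  qed
qed

end
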